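(* Let $\Lambda\in(\mathbb R_+^\ast)^N$, let $\mathfrak B$ be a nonempty bounded subset of $\mathcal M_N(\mathbb C)$, and let $\mathcal M=L^\infty(\mathbb R,\mathfrak B)$. The following statements are equivalent. (i) $\Sigma_\tau(\Lambda,\mathcal M)$ is exponentially stable in $\mathsf Y_p(R)$ for some $p\in[1,+\infty]$ and some $R\in\mathrm{Inv}(\Lambda,\mathcal M)$. (ii) $\Sigma_\tau(L,\mathcal M)$ is exponentially stable in $\mathsf Y_p(R)$ for every $L\in V_+(\Lambda)$, every $p\in[1,+\infty]$, and every $R\in\mathrm{Inv}(L,\mathcal M)$.
   Context: $\mathbb R_+^\ast=(0,+\infty)$, $\mathbb N=\{0,1,2,\dots\}$, and $\mathcal M_{r,N}(\mathbb C)$ is the set of complex $r\times N$ matrices, $\mathcal M_N=\mathcal M_{N,N}$. $L^\infty(\mathbb R,\mathfrak B)$ is the set of measurable functions from $\mathbb R$ to $\mathfrak B$. For $\Lambda\in(\mathbb R_+^\ast)^N$, $Z(\Lambda)=\{\mathbf n\in\mathbb Z^N:\Lambda\cdot\mathbf n=0\}$ and $V_+(\Lambda)=\{L\in(\mathbb R_+^\ast)^N:Z(\Lambda)\subset Z(L)\}$. For $L\in(\mathbb R_+^\ast)^N$ and $M=(m_{ij}):\mathbb R\to\mathcal M_N(\mathbb C)$ in $L^\infty_{\mathrm{loc}}$, the transport system $\Sigma_\tau(L,M)$ is $\partial_tu_i(t,x)+\partial_xu_i(t,x)=0$ for $t\ge0$, $x\in[0,L_i]$, with $u_i(t,0)=\sum_{j=1}^Nm_{ij}(t)u_j(t,L_j)$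 for $t\ge0$, $i\in\{1,\dots,N\}$. The state space is $\mathsf X_p^\tau=\prod_{i=1}^NL^p([0,L_i],\mathbb C)$ with norm $\|u\|_p=(\sum_i\|u_i\|_{L^p}^p)^{1/p}$ ($\max_i\|u_i\|_{L^\infty}$ if $p=\infty$). Solutions are understood as functions constant along characteristics $x-t=$ const and satisfying the boundary condition: the solution with initial condition $u_0=(u_{i,0})\in\mathsf X_p^\tau$ is $u_i(t,x)=v_i(t-x)$, where $v_i(s)=u_{i,0}(-s)$ for a.e. $s\in[-L_i,0)$ and $v_i(t)=\sum_jm_{ij}(t)v_j(t-L_j)$ for a.e. $t\ge0$. For $r\in\mathbb N$ and $R=(\rho_{ij})\in\mathcal M_{r,N}(\mathbb C)$, $\mathsf Y_p(R)=\{u\in\mathsf X_p^\tau:\sum_{j=1}^N\rho_{ij}\int_0^{L_j}u_j(x)\,dx=0\ \forall i\in\{1,\dots,r\}\}$. $\mathrm{Inv}(L,\mathcal M)$ is the set of all matrices $R\in\mathcal M_{r,N}(\mathbb C)$, $r\in\mathbb N$, such that $\mathsf Y_p(R)$ is invariant under the flow of $\Sigma_\tau(L,M)$ for every $M\in\mathcal M$ and every $p\in[1,+\infty]$. $\Sigma_\tau(L,\mathcal M)$ is the family of systems $\Sigma_\tau(L,M)$, $M\in\mathcal M$. For $R\in\mathrm{Inv}(L,\mathcal M)$ it is of exponential type $\gamma\in\mathbb R$ in $\mathsf Y_p(R)$ if for every $\varepsilon>0$ there is $K>0$ such that for all $M\in\mathcal M$ and $u_0\in\mathsf Y_p(R)$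 the solution satisfies $\|u(t)\|_p\le Ke^{(\gamma+\varepsilon)t}\|u_0\|_p$ for all $t\ge0$; it is exponentially stable in $\mathsf Y_p(R)$ if it is of exponential type $\gamma$ for some $\gamma<0$. *)

theory Defs
  imports "HOL-Analysis.Analysis" "HOL-Probability.Essential_Supremum"
begin

definition Z_rel :: "real ^ 'n \<Rightarrow> (int ^ 'n) set" where
  "Z_rel L = {n. (\<Sum>i\<in>UNIV. L $ i * of_int (n $ i)) = 0}"

definition V_plus :: "real ^ 'n \<Rightarrow> (real ^ 'n) set" where
  "V_plus \<Lambda> = {L. (\<forall>i. 0 < L $ i) \<and> Z_rel \<Lambda> \<subseteq> Z_rel L}"

text \<open>The space \<open>L\<^sup>p(A, \<complex>)\<close> is handled through representatives: a function is given on all of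
  \<open>\<real>\<close>, and only its values on \<open>A\<close> (up to null sets) matter.\<close>

definition Lp_mem :: "ereal \<Rightarrow> real set \<Rightarrow> (real \<Rightarrow> complex) \<Rightarrow> bool" where
  "Lp_mem p A f \<longleftrightarrow> f \<in> borel_measurable (lebesgue_on A) \<and>
     (if p = \<infinity> then esssup (lebesgue_on A) (\<lambda>x. ereal (cmod (f x))) < \<infinity>
      else integrable (lebesgue_on A) (\<lambda>x. cmod (f x) powr real_of_ereal p))"

definition Lp_norm :: "ereal \<Rightarrow> real set \<Rightarrow> (real \<Rightarrow> complex) \<Rightarrow> real" where
  "Lp_norm p A f =
     (if p = \<infinity> then real_of_ereal (esssup (lebesgue_on A) (\<lambda>x. ereal (cmod (f x))))
      else (\<integral>x. cmod (f x) powr real_of_ereal p \<partial>lebesgue_on A) powr (1 / real_of_ereal p))"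

definition X_space :: "ereal \<Rightarrow> real ^ 'n \<Rightarrow> ('n \<Rightarrow> real \<Rightarrow> complex) set" where
  "X_space p L = {u. \<forall>i. Lp_mem p {0..L $ i} (u i)}"

definition X_norm :: "ereal \<Rightarrow> real ^ 'n \<Rightarrow> ('n \<Rightarrow> real \<Rightarrow> complex) \<Rightarrow> real" where
  "X_norm p L u =
     (if p = \<infinity> then Max (range (\<lambda>i. Lp_norm p {0..L $ i} (u i)))
      else (\<Sum>i\<in>UNIV. Lp_norm p {0..L $ i} (u i) powr real_of_ereal p) powr (1 / real_of_ereal p))"

text \<open>The function \<open>v\<close> parametrizes a solution by its values along characteristics:
  the solution itself is \<open>u\<^sub>i(t, x) = v\<^sub>i(t - x)\<close>. The values \<open>v\<^sub>i(s)\<close> for \<open>s < - L\<^sub>i\<close>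
  are irrelevant.\<close>

definition transport_solution ::
  "real ^ 'n \<Rightarrow> (real \<Rightarrow> complex ^ 'n ^ 'n) \<Rightarrow> ('n \<Rightarrow> real \<Rightarrow> complex) \<Rightarrow> ('n \<Rightarrow> real \<Rightarrow> complex) \<Rightarrow> bool"
  where
  "transport_solution L M u0 v \<longleftrightarrow>
     (\<forall>i. (AE s in lebesgue_on {- (L $ i)..<0}. v i s = u0 i (- s)) \<and>
          (AE t in lebesgue_on {0..}. v i t = (\<Sum>j\<in>UNIV. M t $ i $ j * v j (t - L $ j))))"

definition state_at :: "('n \<Rightarrow> real \<Rightarrow> complex) \<Rightarrow> real \<Rightarrow> 'n \<Rightarrow> real \<Rightarrow> complex" where
  "state_at v t i x = v i (t - x)"

lemma transport_solution_exists:
  fixes L :: "real ^ 'n"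
  assumes "\<And>i. 0 < L $ i"
  shows "\<exists>v. transport_solution L M u0 v"
proof -
  define d where "d = Min (range (\<lambda>i. L $ i))"
  have d: "0 < d" "\<And>i. d \<le> L $ i"
    using assms by (auto simp: d_def)
  define F where "F g i s = (if s < 0 then u0 i (- s)
      else (\<Sum>j\<in>UNIV. M s $ i $ j * g j (s - L $ j)))" for g :: "'n \<Rightarrow> real \<Rightarrow> complex" and i s
  define f where "f n = (F ^^ n) (\<lambda>i s. u0 i (- s))" for n
  have f_Suc: "f (Suc n) = F (f n)" for n
    by (simp add: f_def)
  have step: "f (Suc n) i s = f n i s" if "s < real n * d" for n i s
    using that
  proof (induction n arbitrary: i s)
    case 0
    then show ?case by (simp add: f_def F_def)
  next
    case (Suc n)
    have "f (Suc n) j (s - L $ j) = f n j (s - L $ j)" for j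
      using Suc.prems d(2)[of j] by (intro Suc.IH) (simp add: algebra_simps)
    then show ?case
      by (simp only: f_Suc[of "Suc n"] f_Suc[of n] F_def)
  qed
  have mono: "f (n + k) i s = f n i s" if "s < real n * d" for n k i s
  proof (induction k)
    case (Suc k)
    have "s < real (n + k) * d"
      using that d(1) by (smt (verit) mult_right_mono of_nat_mono le_add1)
    then show ?case using step[of s "n + k" i] Suc by simp
  qed simp
  define k where "k s = nat (\<lceil>s / d\<rceil> + 1)" for s
  have k: "s < real (k s) * d" for s
  proof -
    have "s / d < real (k s)" unfolding k_def by linarith
    then show ?thesis using d(1) by (simp add: field_simps)
  qed
  define v where "v i s = f (k s) i s" for i s
  have v: "v i s = f n i s" if "s < real n * d" for n i s
    using mono[OF that, of "k s" i] mono[OF k[of s], of n i] by (simp add: v_def add.commute)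
  have "v i s = F v i s" for i s
  proof -
    have "v j (s - L $ j) = f (k s) j (s - L $ j)" for j
      using k[of s] assms[of j] by (intro v) linarith
    moreover have "v i s = f (Suc (k s)) i s"
      using step[OF k[of s], of i] by (simp add: v_def)
    ultimately show ?thesis
      by (simp add: f_Suc F_def)
  qed
  then have "v i s = u0 i (- s)" if "s < 0" for i s
    using that by (simp add: F_def)
  moreover have "v i s = (\<Sum>j\<in>UNIV. M s $ i $ j * v j (s - L $ j))" if "0 \<le> s" for i s
    using \<open>v i s = F v i s\<close> that by (simp add: F_def)
  ultimately show ?thesis
    unfolding transport_solution_def by (intro exI[of _ v] allI conjI AE_I2) auto
qed

text \<open>A matrix \<open>R \<in> \<M>\<^bsub>r,N\<^esub>(\<complex>)\<close> with variable number of rows \<open>r \<ge> 0\<close> is the list of its \<open>r\<close> rows.\<close>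

definition Y_space ::
  "ereal \<Rightarrow> real ^ 'n \<Rightarrow> (complex ^ 'n) list \<Rightarrow> ('n \<Rightarrow> real \<Rightarrow> complex) set" where
  "Y_space p L R = {u \<in> X_space p L.
     \<forall>i<length R. (\<Sum>j\<in>UNIV. R ! i $ j * (\<integral>x. u j x \<partial>lebesgue_on {0..L $ j})) = 0}"

definition flow_invariant ::
  "real ^ 'n \<Rightarrow> (real \<Rightarrow> complex ^ 'n ^ 'n) \<Rightarrow> ('n \<Rightarrow> real \<Rightarrow> complex) set \<Rightarrow> bool" where
  "flow_invariant L M Y \<longleftrightarrow>
     (\<forall>u0\<in>Y. \<forall>v. transport_solution L M u0 v \<longrightarrow> (\<forall>t\<ge>0. state_at v t \<in> Y))"

definition Inv_mats ::
  "real ^ 'n \<Rightarrow> (real \<Rightarrow> complex ^ 'n ^ 'n) set \<Rightarrow> (complex ^ 'n) list set" where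
  "Inv_mats L \<M> = {R. \<forall>M\<in>\<M>. \<forall>p\<ge>1. flow_invariant L M (Y_space p L R)}"

definition exponential_type ::
  "real ^ 'n \<Rightarrow> (real \<Rightarrow> complex ^ 'n ^ 'n) set \<Rightarrow> ereal \<Rightarrow> (complex ^ 'n) list \<Rightarrow> real \<Rightarrow> bool" where
  "exponential_type L \<M> p R \<gamma> \<longleftrightarrow>
     (\<forall>\<epsilon>>0. \<exists>K>0. \<forall>M\<in>\<M>. \<forall>u0\<in>Y_space p L R. \<forall>v. transport_solution L M u0 v \<longrightarrow>
        (\<forall>t\<ge>0. X_norm p L (state_at v t) \<le> K * exp ((\<gamma> + \<epsilon>) * t) * X_norm p L u0))"

definition exponentially_stable ::
  "real ^ 'n \<Rightarrow> (real \<Rightarrow> complex ^ 'n ^ 'n) set \<Rightarrow> ereal \<Rightarrow> (complex ^ 'n) list \<Rightarrow> bool" where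
  "exponentially_stable L \<M> p R \<longleftrightarrow> (\<exists>\<gamma><0. exponential_type L \<M> p R \<gamma>)"

definition measurable_signals ::
  "(complex ^ 'n ^ 'n) set \<Rightarrow> (real \<Rightarrow> complex ^ 'n ^ 'n) set" where
  "measurable_signals B = {M \<in> borel_measurable lebesgue. \<forall>t. M t \<in> B}"

end

theory Submission
  imports Defs
begin

text \<open>
  Iterating the boundary condition expands a solution as
  \<open>v\<^sub>i(t) = \<Sum>\<^sub>j \<Sum>\<^sub>n c\<^sub>i\<^sub>j(n) u\<^sub>j(L \<cdot> n - t)\<close>, where \<open>n\<close> counts how often a path enters each index and
  \<open>c\<^sub>i\<^sub>j(n)\<close> is the sum over all such paths from \<open>i\<close> to \<open>j\<close> of the products of the entries of \<open>M\<close> read at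
  the times \<open>t - L \<cdot> n'\<close>. Stability of the \<open>\<Lambda>\<close>-system on data of mean zero forces the sums of \<open>c\<^sub>i\<^sub>j\<close>
  over a class \<open>{n. \<Lambda> \<cdot> n = y}\<close> to decay exponentially in \<open>y\<close>, uniformly over all assignments of
  matrices of \<open>\<BB>\<close> to classes: a piecewise constant signal realizes the assignment near the relevant
  times, and a short bump of mean zero, which lies in every \<open>Y\<^sub>p(R)\<close>, isolates one class. For
  \<open>L \<in> V\<^sub>+(\<Lambda>)\<close> the value \<open>L \<cdot> n\<close> depends only on the \<open>\<Lambda>\<close>-class of \<open>n\<close>, so the coefficients of the
  \<open>L\<close>-system are of this kind, and only polynomially many classes contribute at time \<open>t\<close>. This bounds
  every solution of the \<open>L\<close>-system in every \<open>L\<^sup>p\<close>.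
\<close>

subsection \<open>Path coefficients\<close>

definition delay :: "real ^ 'n \<Rightarrow> ('n \<Rightarrow> nat) \<Rightarrow> real" where
  "delay L n = (\<Sum>i\<in>UNIV. L $ i * real (n i))"

text \<open>The sum over all paths from \<open>i\<close> to \<open>j\<close> that enter each vertex \<open>k\<close> exactly \<open>n k\<close> times, of the
  product of the matrix entries along the path; the matrix used at a step depends on the counts so far.\<close>

function path_coeff ::
  "(('n::finite \<Rightarrow> nat) \<Rightarrow> complex ^ 'n ^ 'n) \<Rightarrow> 'n \<Rightarrow> ('n \<Rightarrow> nat) \<Rightarrow> 'n \<Rightarrow> complex" where
  "path_coeff m i n j =
     (if n = (\<lambda>_. 0) then (if i = j then 1 else 0)
      else if n j = 0 then 0
      else (\<Sum>k\<in>UNIV. path_coeff m i (n(j := n j - 1)) k * m (n(j := n j - 1)) $ k $ j))"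
  by pat_completeness auto
termination
proof (relation "Wellfounded.measure (\<lambda>(m, i, n, j). sum n UNIV)", goal_cases)
  case (2 m i n j k)
  have "sum (n(j := n j - 1)) UNIV < sum n UNIV"
    using 2 by (intro sum_strict_mono_ex1) auto
  then show ?case by simp
qed simp

declare path_coeff.simps [simp del]

lemma path_coeff_zero: "path_coeff m i (\<lambda>_. 0) j = (if i = j then 1 else 0)"
  by (simp add: path_coeff.simps)

lemma path_coeff_eq_0: "n j = 0 \<Longrightarrow> n \<noteq> (\<lambda>_. 0) \<Longrightarrow> path_coeff m i n j = 0"
  by (simp add: path_coeff.simps)

text \<open>The recursion read forwards, as needed to extend a path by one step: the matrix applied
  is the one attached to the counts before the step.\<close>

lemma path_coeff_step:
  "path_coeff m i (n(j := Suc (n j))) j = (\<Sum>k\<in>UNIV. path_coeff m i n k * m n $ k $ j)"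
proof -
  have "n(j := Suc (n j)) \<noteq> (\<lambda>_. 0)"
    by (metis fun_upd_same nat.distinct(1))
  then show ?thesis
    by (subst path_coeff.simps) (simp del: fun_upd_apply, simp)
qed

text \<open>A path with counts \<open>n\<close> passes only through counts below \<open>n\<close>.
  Hence a signal that realizes \<open>m\<close> merely up to a bounded delay has the same
  coefficients there.\<close>

lemma path_coeff_cong:
  assumes "\<And>n'. n' \<le> n \<Longrightarrow> m n' = m' n'"
  shows "path_coeff m i n j = path_coeff m' i n j"
  using assms
proof (induction m i n j rule: path_coeff.induct)
  case (1 m i n j)
  show ?case
  proof (cases "n = (\<lambda>_. 0) \<or> n j = 0")
    case True
    then show ?thesis by (auto simp: path_coeff.simps)
  next
    case False
    have le: "n(j := n j - 1) \<le> n" by (auto simp: le_fun_def)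
    have "path_coeff m i (n(j := n j - 1)) k = path_coeff m' i (n(j := n j - 1)) k" for k
      using False 1(2)[OF order_trans[OF _ le]] by (intro 1(1)) (simp_all del: fun_upd_apply)
    moreover have "m (n(j := n j - 1)) = m' (n(j := n j - 1))"
      using le 1(2) by blast
    ultimately show ?thesis
      using False by (subst (1 2) path_coeff.simps) simp
  qed
qed

section \<open>Delays and the number of count vectors up to a given delay\<close>

lemma delay_zero [simp]: "delay L (\<lambda>_. 0) = 0"
  by (simp add: delay_def)

lemma delay_add: "delay L (n(j := n j + k)) = delay L n + real k * L $ j"
proof -
  have "delay L (n(j := n j + k)) = (\<Sum>i\<in>UNIV. L $ i * real (n i) + (if i = j then real k * L $ j else 0))"
    unfolding delay_def by (intro sum.cong) (auto simp: algebra_simps)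
  then show ?thesis by (simp add: sum.distrib delay_def)
qed

lemma delay_Suc: "delay L (n(j := Suc (n j))) = delay L n + L $ j"
  using delay_add[of L n j 1] by simp

lemma delay_mono:
  assumes "\<And>i. 0 < L $ i" "n' \<le> n"
  shows "delay L n' \<le> delay L n"
  unfolding delay_def using assms
  by (intro sum_mono mult_left_mono) (auto simp: le_fun_def less_imp_le)

lemma delay_component_le:
  assumes "\<And>i. 0 < L $ i"
  shows "L $ i * real (n i) \<le> delay L n"
  unfolding delay_def using assms
  by (intro member_le_sum) (auto simp: less_imp_le)

lemma component_le_delay:
  assumes "\<And>i. 0 < L $ i" "n j \<noteq> 0"
  shows "L $ j \<le> delay L n"
proof -
  have "L $ j * 1 \<le> L $ j * real (n j)"
    using assms by (intro mult_left_mono) (auto simp: less_imp_le)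
  with delay_component_le[OF assms(1), of j n] show ?thesis by simp
qed

text \<open>Each count is at most \<open>X / d\<close>, where \<open>d\<close> is the least
  component of \<open>L\<close>. The growth is polynomial in \<open>X\<close>, so exponentially
  small coefficients stay small after summation.\<close>

lemma finite_card_delay_le:
  fixes L :: "real ^ 'n"
  assumes "\<And>i. 0 < L $ i"
  shows "\<exists>d>0. \<forall>X\<ge>0. finite {n. delay L n \<le> X} \<and>
    real (card {n. delay L n \<le> X}) \<le> (X / d + 1) ^ CARD('n)"
proof -
  define d where "d = Min (range (\<lambda>i. L $ i))"
  have d: "0 < d" "\<And>i. d \<le> L $ i"
    using assms by (auto simp: d_def)
  have "finite {n. delay L n \<le> X} \<and> real (card {n. delay L n \<le> X}) \<le> (X / d + 1) ^ CARD('n)"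
    if "0 \<le> X" for X
  proof -
    define k where "k = nat \<lfloor>X / d\<rfloor>"
    have "n i \<le> k" if "delay L n \<le> X" for n :: "'n \<Rightarrow> nat" and i
    proof -
      have "d * real (n i) \<le> L $ i * real (n i)"
        using d by (intro mult_right_mono) auto
      also have "\<dots> \<le> X" using delay_component_le[OF assms, of i n] that by simp
      finally have "real (n i) \<le> X / d" using d by (simp add: field_simps)
      then show ?thesis unfolding k_def by linarith
    qed
    then have sub: "{n. delay L n \<le> X} \<subseteq> PiE UNIV (\<lambda>_. {..k})"
      by auto
    have fin: "finite (PiE UNIV (\<lambda>_::'n. {..k}))"
      by (intro finite_PiE) auto
    have "card {n. delay L n \<le> X} \<le> card (PiE UNIV (\<lambda>_::'n. {..k}))"
      using card_mono[OF fin sub] .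
    also have "\<dots> = (k + 1) ^ CARD('n)" by (simp add: card_PiE)
    finally have "real (card {n. delay L n \<le> X}) \<le> real ((k + 1) ^ CARD('n))"
      using of_nat_mono by blast
    also have "\<dots> = (real k + 1) ^ CARD('n)" by (simp add: add.commute)
    also have "\<dots> \<le> (X / d + 1) ^ CARD('n)"
      using that d unfolding k_def by (intro power_mono) auto
    finally show ?thesis using finite_subset[OF sub fin] by blast
  qed
  with d show ?thesis by blast
qed

lemma finite_delay_le:
  assumes "\<And>i. 0 < L $ i"
  shows "finite {n. delay L n \<le> X}"
proof -
  have "finite {n. delay L n \<le> max X 0}"
    using finite_card_delay_le[OF assms] by (metis max.cobounded2)
  then show ?thesis by (rule finite_subset[rotated]) auto
qed

text \<open>Summation by parts: moving the sum over \<open>delay L n \<le> t\<close> one step along the recursion reproduces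
  it up to the term at \<open>0\<close> and the terms that have just crossed the level \<open>t\<close>.\<close>

lemma recursion_frontier_expansion:
  fixes L :: "real ^ 'n" and V :: "'n \<Rightarrow> ('n \<Rightarrow> nat) \<Rightarrow> complex"
  assumes L: "\<And>i. 0 < L $ i" and t: "0 \<le> t"
    and rec: "\<And>n k. delay L n \<le> t \<Longrightarrow> V k n = (\<Sum>j\<in>UNIV. m n $ k $ j * V j (n(j := Suc (n j))))"
  shows "V i (\<lambda>_. 0) = (\<Sum>j\<in>UNIV. \<Sum>n | n j \<noteq> 0 \<and> delay L n - L $ j \<le> t \<and> t < delay L n.
    path_coeff m i n j * V j n)"
proof -
  define P where "P = path_coeff m i"
  \<comment> \<open>A step into \<open>j\<close> from a count in \<open>G\<close> ends either in
    \<open>G\<close> again, and then in \<open>H j\<close>, or just beyond the level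
    \<open>t\<close>, in \<open>F j\<close>.\<close>
  define G where "G = {n. delay L n \<le> t}"
  define F where "F j = {n. n j \<noteq> 0 \<and> delay L n - L $ j \<le> t \<and> t < delay L n}" for j
  define H where "H j = {n\<in>G. n j \<noteq> 0}" for j
  have fG: "finite G" unfolding G_def using finite_delay_le[OF L] .
  have fF: "finite (F j)" for j
    by (rule finite_subset[OF _ finite_delay_le[OF L, of "t + L $ j"]]) (auto simp: F_def)
  have fH: "finite (H j)" for j using fG by (auto simp: H_def)
  have shift: "(\<Sum>n\<in>G. P (n(j := Suc (n j))) j * V j (n(j := Suc (n j)))) =
      (\<Sum>n\<in>H j \<union> F j. P n j * V j n)" for j
  proof (rule sum.reindex_bij_witness[of _ "\<lambda>n. n(j := n j - 1)" "\<lambda>n. n(j := Suc (n j))"], goal_cases)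
    case (4 n)
    define n' where "n' = n(j := n j - 1)"
    have "n = n'(j := Suc (n' j))" using 4 by (auto simp: H_def F_def n'_def)
    then have "delay L n = delay L n' + L $ j" by (metis delay_Suc)
    then show ?case using 4 L[of j] unfolding n'_def[symmetric] by (auto simp: H_def F_def G_def)
  next
    case (2 n)
    then show ?case using L[of j] by (auto simp: H_def F_def G_def delay_Suc)
  qed (auto simp: H_def F_def)
  have "(\<Sum>j\<in>UNIV. \<Sum>n\<in>G. P n j * V j n) =
      (\<Sum>n\<in>G. \<Sum>k\<in>UNIV. P n k * (\<Sum>j\<in>UNIV. m n $ k $ j * V j (n(j := Suc (n j)))))"
    using rec by (subst sum.swap) (auto simp: G_def intro!: sum.cong)
  also have "\<dots> = (\<Sum>n\<in>G. \<Sum>j\<in>UNIV. P (n(j := Suc (n j))) j * V j (n(j := Suc (n j))))"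
  proof (rule sum.cong[OF refl])
    fix n
    show "(\<Sum>k\<in>UNIV. P n k * (\<Sum>j\<in>UNIV. m n $ k $ j * V j (n(j := Suc (n j))))) =
        (\<Sum>j\<in>UNIV. P (n(j := Suc (n j))) j * V j (n(j := Suc (n j))))"
      unfolding P_def path_coeff_step sum_distrib_left sum_distrib_right
      by (subst sum.swap) (simp add: mult.assoc)
  qed
  also have "\<dots> = (\<Sum>j\<in>UNIV. \<Sum>n\<in>H j \<union> F j. P n j * V j n)"
    by (subst sum.swap) (simp add: shift)
  also have "\<dots> = (\<Sum>j\<in>UNIV. (\<Sum>n\<in>H j. P n j * V j n) + (\<Sum>n\<in>F j. P n j * V j n))"
    using fH fF by (intro sum.cong sum.union_disjoint) (auto simp: H_def F_def G_def)
  finally have 1: "(\<Sum>j\<in>UNIV. \<Sum>n\<in>G. P n j * V j n) = \<dots>" .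
  \<comment> \<open>The only count in \<open>G\<close> outside \<open>H j\<close> whose coefficient
    can be nonzero is the zero count.\<close>
  have "(\<Sum>n\<in>G. P n j * V j n) = (if i = j then V i (\<lambda>_. 0) else 0) + (\<Sum>n\<in>H j. P n j * V j n)" for j
  proof -
    have "(\<Sum>n\<in>G. P n j * V j n) = (\<Sum>n\<in>insert (\<lambda>_. 0) (H j). P n j * V j n)"
      using fG t by (intro sum.mono_neutral_right) (auto simp: H_def G_def P_def path_coeff_eq_0)
    also have "\<dots> = P (\<lambda>_. 0) j * V j (\<lambda>_. 0) + (\<Sum>n\<in>H j. P n j * V j n)"
      using fH by (intro sum.insert) (auto simp: H_def)
    finally show ?thesis by (simp add: P_def path_coeff_zero)
  qed
  \<comment> \<open>The sums over \<open>H j\<close> occur on both sides and cancel, which leaves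
    the start and the frontier.\<close>
  with 1 have "(\<Sum>j\<in>UNIV. if i = j then V i (\<lambda>_. 0) else 0) = (\<Sum>j\<in>UNIV. \<Sum>n\<in>F j. P n j * V j n)"
    by (simp add: sum.distrib)
  then show ?thesis by (simp add: F_def P_def)
qed

subsection \<open>Expansion of solutions\<close>

lemma lebesgue_measurable_affine:
  fixes a c :: real
  assumes "c \<noteq> 0"
  shows "(\<lambda>x. a + c * x) \<in> lebesgue \<rightarrow>\<^sub>M lebesgue"
  using lebesgue_affine_measurable[where c = "\<lambda>x::real. c" and t = a] assms by simp

text \<open>An affine bijection changes Lebesgue measure only by the constant density
  \<open>\<bar>c\<bar>\<close>, so it pulls null sets back to null sets.\<close>

lemma AE_lebesgue_affine:
  fixes a c :: real
  assumes "AE x in lebesgue. P x" "c \<noteq> 0"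
  shows "AE x in lebesgue. P (a + c * x)"
proof -
  have "AE x in density (distr lebesgue lebesgue (\<lambda>x. a + c * x)) (\<lambda>_. ennreal \<bar>c\<bar>). P x"
    using assms(1) unfolding lebesgue_real_affine[OF assms(2), of a, symmetric] .
  then have "AE x in distr lebesgue lebesgue (\<lambda>x. a + c * x). P x"
    using assms(2) by (subst (asm) AE_density) auto
  then show ?thesis
    using AE_distrD[OF lebesgue_measurable_affine[OF assms(2)]] by blast
qed

text \<open>The interval \<open>(0, L $ j]\<close> mirrors \<open>{- (L $ j)..<0}\<close>, where
  \<open>v j\<close> is given by the datum. Extending by zero absorbs the frontier condition into
  the datum, so that sums can run over a set of counts that does not depend on
  \<open>t\<close>.\<close>

definition cutoff :: "real ^ 'n \<Rightarrow> ('n \<Rightarrow> real \<Rightarrow> complex) \<Rightarrow> 'n \<Rightarrow> real \<Rightarrow> complex" where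
  "cutoff L u j y = (if 0 < y \<and> y \<le> L $ j then u j y else 0)"

text \<open>The equations hold only almost everywhere, but there are countably many counts, so one
  null set of \<open>t\<close> serves all translates \<open>t - delay L n\<close>.\<close>

lemma transport_solution_lattice:
  assumes "transport_solution L M u0 v"
  shows "AE t in lebesgue. \<forall>n i.
    (- (L $ i) \<le> t - delay L n \<and> t - delay L n < 0 \<longrightarrow> v i (t - delay L n) = u0 i (delay L n - t)) \<and>
    (0 \<le> t - delay L n \<longrightarrow> v i (t - delay L n) =
       (\<Sum>j\<in>UNIV. M (t - delay L n) $ i $ j * v j (t - delay L n - L $ j)))"
proof -
  define Q where "Q i t \<longleftrightarrow>
      (- (L $ i) \<le> t \<and> t < 0 \<longrightarrow> v i t = u0 i (- t)) \<and>
      (0 \<le> t \<longrightarrow> v i t = (\<Sum>j\<in>UNIV. M t $ i $ j * v j (t - L $ j)))" for i t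
  have "AE t in lebesgue. Q i t" for i
    using assms unfolding transport_solution_def Q_def
    by (simp add: AE_restrict_space_iff AE_conj_iff)
  then have "AE t in lebesgue. Q i (- delay L n + 1 * t)" for n i
    by (intro AE_lebesgue_affine) auto
  then have "AE t in lebesgue. \<forall>n i. Q i (t - delay L n)"
    by (simp add: AE_all_countable)
  then show ?thesis by (simp add: Q_def)
qed

text \<open>For \<open>t \<ge> 0\<close> this is the frontier expansion applied to
  \<open>v j (t - delay L n)\<close>: on the frontier these values are given by the datum, and off
  it the terms vanish. The level \<open>X\<close> is large enough to contain every frontier up to
  time \<open>T\<close>.\<close>

lemma transport_solution_expansion:
  fixes L :: "real ^ 'n"
  assumes L: "\<And>i. 0 < L $ i" and sol: "transport_solution L M u0 v"
    and X: "0 \<le> X" "\<And>j. T + L $ j \<le> X"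
  shows "AE t in lebesgue. \<forall>i. - (L $ i) \<le> t \<and> t \<le> T \<longrightarrow> v i t =
    (\<Sum>j\<in>UNIV. \<Sum>n | delay L n \<le> X.
      path_coeff (\<lambda>n. M (t - delay L n)) i n j * cutoff L u0 j (delay L n - t))"
  using transport_solution_lattice[OF sol]
proof (rule AE_mp, intro AE_I2 impI allI)
  fix t i
  assume good: "\<forall>n i.
    (- (L $ i) \<le> t - delay L n \<and> t - delay L n < 0 \<longrightarrow> v i (t - delay L n) = u0 i (delay L n - t)) \<and>
    (0 \<le> t - delay L n \<longrightarrow> v i (t - delay L n) =
       (\<Sum>j\<in>UNIV. M (t - delay L n) $ i $ j * v j (t - delay L n - L $ j)))"
    and t: "- (L $ i) \<le> t \<and> t \<le> T"
  define P where "P = path_coeff (\<lambda>n. M (t - delay L n)) i"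
  have fin: "finite {n. delay L n \<le> X}"
    by (rule finite_delay_le[OF L])
  have "v i t = (\<Sum>j\<in>UNIV. \<Sum>n | delay L n \<le> X. P n j * cutoff L u0 j (delay L n - t))"
  proof (cases "0 \<le> t")
    case True
    define F where "F j = {n. n j \<noteq> 0 \<and> delay L n - L $ j \<le> t \<and> t < delay L n}" for j
    have "v i (t - delay L (\<lambda>_. 0)) = (\<Sum>j\<in>UNIV. \<Sum>n\<in>F j. P n j * v j (t - delay L n))"
      unfolding P_def F_def using good
      by (intro recursion_frontier_expansion[OF L True]) (simp add: delay_Suc algebra_simps)
    also have "\<dots> = (\<Sum>j\<in>UNIV. \<Sum>n | delay L n \<le> X. P n j * cutoff L u0 j (delay L n - t))"
    proof (rule sum.cong[OF refl], rule sum.mono_neutral_cong_left[OF fin])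
      fix j
      show "F j \<subseteq> {n. delay L n \<le> X}"
        using X(2)[of j] t by (auto simp: F_def)
      show "\<forall>n\<in>{n. delay L n \<le> X} - F j. P n j * cutoff L u0 j (delay L n - t) = 0"
      proof
        fix n assume n: "n \<in> {n. delay L n \<le> X} - F j"
        show "P n j * cutoff L u0 j (delay L n - t) = 0"
        proof (cases "n j = 0 \<and> n \<noteq> (\<lambda>_. 0)")
          case True
          then show ?thesis by (simp add: P_def path_coeff_eq_0)
        next
          case False
          \<comment> \<open>The zero count reads the cutoff at \<open>- t \<le> 0\<close>. A count
            with \<open>n j \<noteq> 0\<close> off the frontier reads it at a point outside
            \<open>(0, L $ j]\<close>.\<close>
          then have "n = (\<lambda>_. 0) \<or> n j \<noteq> 0" by metis
          then have "cutoff L u0 j (delay L n - t) = 0"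
            using n \<open>0 \<le> t\<close> by (auto simp: cutoff_def F_def)
          then show ?thesis by simp
        qed
      qed
      show "P n j * v j (t - delay L n) = P n j * cutoff L u0 j (delay L n - t)" if "n \<in> F j" for n
        using that good by (auto simp: F_def cutoff_def)
    qed
    finally show ?thesis by simp
  next
    case False
    \<comment> \<open>At negative times only the empty path contributes: any other path ending at
      \<open>j\<close> has delay at least \<open>L $ j\<close>, so it reads the cutoff beyond
      \<open>L $ j\<close>.\<close>
    have "(\<Sum>n | delay L n \<le> X. P n j * cutoff L u0 j (delay L n - t)) =
        (\<Sum>n\<in>{\<lambda>_. 0}. P n j * cutoff L u0 j (delay L n - t))" for j
    proof (rule sum.mono_neutral_right[OF fin])
      show "\<forall>n\<in>{n. delay L n \<le> X} - {\<lambda>_. 0}. P n j * cutoff L u0 j (delay L n - t) = 0"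
      proof
        fix n assume n: "n \<in> {n. delay L n \<le> X} - {\<lambda>_. 0}"
        show "P n j * cutoff L u0 j (delay L n - t) = 0"
        proof (cases "n j = 0")
          case True
          then show ?thesis using n by (simp add: P_def path_coeff_eq_0)
        next
          case nj: False
          have "L $ j \<le> delay L n" by (rule component_le_delay[OF L]) (rule nj)
          then show ?thesis using False by (simp add: cutoff_def)
        qed
      qed
    qed (use X in simp)
    then have "(\<Sum>j\<in>UNIV. \<Sum>n | delay L n \<le> X. P n j * cutoff L u0 j (delay L n - t)) =
        (\<Sum>j\<in>UNIV. if i = j then cutoff L u0 j (- t) else 0)"
      by (intro sum.cong) (auto simp: P_def path_coeff_zero)
    also have "\<dots> = u0 i (- t)"
      using False t by (simp add: cutoff_def)
    also have "\<dots> = v i t"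
      using False t good[rule_format, of i "\<lambda>_. 0"] by simp
    finally show ?thesis by simp
  qed
  then show "v i t = (\<Sum>j\<in>UNIV. \<Sum>n | delay L n \<le> X.
      path_coeff (\<lambda>n. M (t - delay L n)) i n j * cutoff L u0 j (delay L n - t))"
    by (simp add: P_def)
qed

subsection \<open>Estimates in the state space\<close>

lemma ereal_ge_1_cases:
  fixes p :: ereal
  assumes "1 \<le> p"
  obtains "p = \<infinity>" | r where "p = ereal r" "1 \<le> r"
  using assms by (cases p) auto

lemma powr_powr_inverse: "0 \<le> x \<Longrightarrow> 1 \<le> r \<Longrightarrow> (x powr r) powr (1 / r) = (x :: real)"
  by (simp add: powr_powr)

text \<open>On a null set the essential supremum would be \<open>- \<infinity>\<close>; the positive
  length of the interval excludes this.\<close>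

lemma esssup_cmod_nonneg:
  fixes l :: real
  assumes "0 < l"
  shows "0 \<le> esssup (lebesgue_on {0..l}) (\<lambda>x. ereal (cmod (f x)))"
proof -
  have "esssup (lebesgue_on {0..l}) (\<lambda>x. 0::ereal) \<le> esssup (lebesgue_on {0..l}) (\<lambda>x. ereal (cmod (f x)))"
    by (intro esssup_mono) auto
  moreover have "esssup (lebesgue_on {0..l}) (\<lambda>x. 0::ereal) = 0"
  proof (rule esssup_const)
    have "emeasure (lebesgue_on {0..l}) {0..l} = ennreal l"
      using assms by (subst emeasure_restrict_space) auto
    then show "emeasure (lebesgue_on {0..l}) (space (lebesgue_on {0..l})) \<noteq> 0"
      using assms by simp
  qed
  ultimately show ?thesis by simp
qed

lemma Lp_norm_nonneg: "0 < l \<Longrightarrow> 0 \<le> Lp_norm p {0..l} f"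
  by (auto simp: Lp_norm_def intro: real_of_ereal_pos esssup_cmod_nonneg)

lemma AE_cmod_le_Lp_norm_infinity:
  assumes "0 < l" "Lp_mem \<infinity> {0..l} f"
  shows "AE x in lebesgue_on {0..l}. cmod (f x) \<le> Lp_norm \<infinity> {0..l} f"
proof -
  let ?e = "esssup (lebesgue_on {0..l}) (\<lambda>x. ereal (cmod (f x)))"
  have "?e < \<infinity>" "0 \<le> ?e"
    using assms esssup_cmod_nonneg by (auto simp: Lp_mem_def)
  then have "?e = ereal (Lp_norm \<infinity> {0..l} f)"
    by (cases ?e) (auto simp: Lp_norm_def)
  then show ?thesis
    using esssup_AE[of "\<lambda>x. ereal (cmod (f x))" "lebesgue_on {0..l}"] by simp
qed

lemma Lp_norm_infinity_le:
  assumes "0 < l" and f: "f \<in> borel_measurable (lebesgue_on {0..l})"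
    and "AE x in lebesgue_on {0..l}. cmod (f x) \<le> C"
  shows "Lp_mem \<infinity> {0..l} f \<and> Lp_norm \<infinity> {0..l} f \<le> C"
proof -
  let ?e = "esssup (lebesgue_on {0..l}) (\<lambda>x. ereal (cmod (f x)))"
  have "?e \<le> ereal C"
    using assms by (intro esssup_I) auto
  moreover have "0 \<le> ?e" using assms esssup_cmod_nonneg by auto
  ultimately show ?thesis using f
    by (cases ?e) (auto simp: Lp_mem_def Lp_norm_def)
qed

lemma Lp_norm_powr:
  "1 \<le> r \<Longrightarrow> Lp_norm (ereal r) A f powr r = (\<integral>x. cmod (f x) powr r \<partial>lebesgue_on A)"
  by (simp add: Lp_norm_def powr_powr)

lemma Lp_norm_le:
  assumes "1 \<le> r" "0 \<le> D" "(\<integral>x. cmod (f x) powr r \<partial>lebesgue_on A) \<le> D powr r"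
  shows "Lp_norm (ereal r) A f \<le> D"
proof -
  have "Lp_norm (ereal r) A f \<le> (D powr r) powr (1 / r)"
    using assms by (auto simp: Lp_norm_def intro!: powr_mono2)
  then show ?thesis using assms powr_powr_inverse[of D r] by simp
qed

lemma Lp_norm_le_X_norm:
  assumes L: "\<And>i. 0 < L $ i" and p: "1 \<le> p"
  shows "Lp_norm p {0..L $ i} (u i) \<le> X_norm p L u"
  using p
proof (cases rule: ereal_ge_1_cases)
  case 1
  then show ?thesis by (auto simp: X_norm_def)
next
  case (2 r)
  let ?a = "\<lambda>i. Lp_norm p {0..L $ i} (u i)"
  have "?a i powr r \<le> (\<Sum>i\<in>UNIV. ?a i powr r)"
    by (intro member_le_sum) auto
  then have "(?a i powr r) powr (1 / r) \<le> (\<Sum>i\<in>UNIV. ?a i powr r) powr (1 / r)"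
    using 2 by (intro powr_mono2) auto
  then show ?thesis
    using 2 powr_powr_inverse[of "?a i" r] Lp_norm_nonneg[OF L] by (simp add: X_norm_def)
qed

lemma X_norm_nonneg:
  assumes "\<And>i. 0 < L $ i" "1 \<le> p"
  shows "0 \<le> X_norm p L u"
  using Lp_norm_le_X_norm[OF assms] Lp_norm_nonneg[OF assms(1)] order_trans by blast

text \<open>The crude factor \<open>CARD('n)\<close>, in place of its root of order
  \<open>p\<close>, makes the constant independent of \<open>p\<close> and covers
  \<open>p = \<infinity>\<close>.\<close>

lemma X_norm_le:
  fixes L :: "real ^ 'n"
  assumes L: "\<And>i. 0 < L $ i" and p: "1 \<le> p" and D: "0 \<le> D"
    and le: "\<And>i. Lp_norm p {0..L $ i} (u i) \<le> D"
  shows "X_norm p L u \<le> real CARD('n) * D"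
  using p
proof (cases rule: ereal_ge_1_cases)
  case 1
  then have "X_norm p L u \<le> D" using le by (simp add: X_norm_def)
  also have "D \<le> real CARD('n) * D" using D by (simp add: mult_le_cancel_right1 Suc_leI)
  finally show ?thesis .
next
  case (2 r)
  have N: "1 \<le> real CARD('n)" by (simp add: Suc_leI)
  let ?a = "\<lambda>i. Lp_norm p {0..L $ i} (u i)"
  have "(\<Sum>i\<in>UNIV. ?a i powr r) \<le> (\<Sum>i\<in>(UNIV::'n set). D powr r)"
    using 2 le Lp_norm_nonneg[OF L] by (intro sum_mono powr_mono2) auto
  also have "\<dots> = real CARD('n) powr 1 * D powr r" by simp
  also have "\<dots> \<le> real CARD('n) powr r * D powr r"
    using 2 N by (intro mult_right_mono powr_mono) auto
  also have "\<dots> = (real CARD('n) * D) powr r"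
    using D by (simp add: powr_mult)
  finally have "(\<Sum>i\<in>UNIV. ?a i powr r) powr (1 / r) \<le> ((real CARD('n) * D) powr r) powr (1 / r)"
    using 2 by (intro powr_mono2) (auto intro: sum_nonneg)
  also have "\<dots> = real CARD('n) * D"
    using 2 D by (intro powr_powr_inverse) auto
  finally show ?thesis using 2 by (simp add: X_norm_def)
qed

text \<open>Every summand is at most the largest one. This replaces convexity at the price of a
  larger constant.\<close>

lemma sum_powr_le:
  fixes b :: "'k \<Rightarrow> real"
  assumes "finite I" "1 \<le> r" "\<And>k. k \<in> I \<Longrightarrow> 0 \<le> b k"
  shows "(\<Sum>k\<in>I. b k) powr r \<le> real (card I) powr r * (\<Sum>k\<in>I. b k powr r)"
proof (cases "I = {}")
  case False
  have "Max (b ` I) \<in> b ` I" using assms False by (intro Max_in) auto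
  then obtain k where k: "k \<in> I" "b k = Max (b ` I)" by auto
  then have "(\<Sum>k\<in>I. b k) \<le> (\<Sum>l\<in>I. b k)"
    using assms by (intro sum_mono) auto
  then have "(\<Sum>k\<in>I. b k) powr r \<le> (real (card I) * b k) powr r"
    using assms by (intro powr_mono2) (auto intro: sum_nonneg)
  also have "\<dots> = real (card I) powr r * b k powr r"
    using assms k by (simp add: powr_mult)
  also have "\<dots> \<le> real (card I) powr r * (\<Sum>k\<in>I. b k powr r)"
    using assms k by (intro mult_left_mono member_le_sum) auto
  finally show ?thesis .
qed simp

section \<open>Data extended by zero and domination in L^p\<close>

lemma X_spaceD: "u \<in> X_space p L \<Longrightarrow> Lp_mem p {0..L $ j} (u j)"
  by (simp add: X_space_def)

lemma cutoff_measurable: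
  assumes "u \<in> X_space p L"
  shows "cutoff L u j \<in> borel_measurable lebesgue"
proof -
  have h: "(\<lambda>x. indicator {0..L $ j} x *\<^sub>R u j x) \<in> borel_measurable lebesgue"
    using X_spaceD[OF assms, of j]
    by (auto simp: Lp_mem_def borel_measurable_restrict_space_iff)
  have "(\<lambda>x. indicator {0<..L $ j} x *\<^sub>R indicator {0..L $ j} x *\<^sub>R u j x) \<in> borel_measurable lebesgue"
    by (intro borel_measurable_scaleR[OF _ h] borel_measurable_indicator) simp
  also have "(\<lambda>x. indicator {0<..L $ j} x *\<^sub>R indicator {0..L $ j} x *\<^sub>R u j x) = cutoff L u j"
    by (auto simp: cutoff_def indicator_def)
  finally show ?thesis .
qed

lemma cutoff_affine_measurable:
  assumes "u \<in> X_space p L" "c \<noteq> 0"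
  shows "(\<lambda>x. cutoff L u j (a + c * x)) \<in> borel_measurable lebesgue"
  using measurable_compose[OF lebesgue_measurable_affine cutoff_measurable] assms by blast

lemma cutoff_powr_integral:
  assumes "u \<in> X_space (ereal r) L" "1 \<le> r"
  shows "integrable lebesgue (\<lambda>x. cmod (cutoff L u j (a + x)) powr r)"
    "(\<integral>x. cmod (cutoff L u j (a + x)) powr r \<partial>lebesgue) \<le> Lp_norm (ereal r) {0..L $ j} (u j) powr r"
proof -
  let ?g = "\<lambda>x. indicator {0..L $ j} x *\<^sub>R (cmod (u j x) powr r)"
  have g: "integrable lebesgue ?g"
    using X_spaceD[OF assms(1), of j] by (simp add: Lp_mem_def integrable_restrict_space)
  have f: "integrable lebesgue (\<lambda>x. cmod (cutoff L u j x) powr r)"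
  proof (rule Bochner_Integration.integrable_bound[OF g])
    show "(\<lambda>x. cmod (cutoff L u j x) powr r) \<in> borel_measurable lebesgue"
      using cutoff_measurable[OF assms(1), of j] by measurable
  qed (auto simp: cutoff_def indicator_def)
  then show "integrable lebesgue (\<lambda>x. cmod (cutoff L u j (a + x)) powr r)"
    using lebesgue_integrable_real_affine_iff[of 1 "\<lambda>x. cmod (cutoff L u j x) powr r" a] by simp
  have "(\<integral>x. cmod (cutoff L u j (a + x)) powr r \<partial>lebesgue) = (\<integral>x. cmod (cutoff L u j x) powr r \<partial>lebesgue)"
    using lebesgue_integral_real_affine[of 1 "\<lambda>x. cmod (cutoff L u j x) powr r" a] by simp
  also have "\<dots> \<le> integral\<^sup>L lebesgue ?g"
    using f g by (intro integral_mono) (auto simp: cutoff_def indicator_def)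
  also have "\<dots> = (\<integral>x. cmod (u j x) powr r \<partial>lebesgue_on {0..L $ j})"
    by (simp add: integral_restrict_space)
  also have "\<dots> = Lp_norm (ereal r) {0..L $ j} (u j) powr r"
    using assms by (simp add: Lp_norm_powr)
  finally show "(\<integral>x. cmod (cutoff L u j (a + x)) powr r \<partial>lebesgue) \<le> Lp_norm (ereal r) {0..L $ j} (u j) powr r" .
qed

lemma cutoff_le_X_norm:
  assumes L: "\<And>i. 0 < L $ i" and u: "u \<in> X_space \<infinity> L"
  shows "AE x in lebesgue. cmod (cutoff L u j (a + x)) \<le> X_norm \<infinity> L u"
proof -
  have "AE x in lebesgue_on {0..L $ j}. cmod (u j x) \<le> Lp_norm \<infinity> {0..L $ j} (u j)"
    using L X_spaceD[OF u] by (intro AE_cmod_le_Lp_norm_infinity) auto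
  then have "AE x in lebesgue. x \<in> {0..L $ j} \<longrightarrow> cmod (u j x) \<le> Lp_norm \<infinity> {0..L $ j} (u j)"
    by (simp add: AE_restrict_space_iff)
  then have "AE x in lebesgue. cmod (cutoff L u j x) \<le> X_norm \<infinity> L u"
    using Lp_norm_le_X_norm[OF L, of \<infinity> j u] X_norm_nonneg[OF L, of \<infinity> u]
    by (auto simp: cutoff_def elim!: AE_mp)
  from AE_lebesgue_affine[OF this, of 1 a] show ?thesis by simp
qed

text \<open>By translation invariance each shifted cutoff has norm at most
  \<open>X_norm p L u\<close>. For finite \<open>p\<close> one factor \<open>card I\<close> comes
  from raising the sum to the power and one from adding the integrals, so the constant is the same
  for all \<open>p\<close>.\<close>

lemma Lp_dominated:
  fixes L :: "real ^ 'n" and a :: "'k \<Rightarrow> real" and j :: "'k \<Rightarrow> 'n"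
  assumes L: "\<And>i. 0 < L $ i" and p: "1 \<le> p" and u: "u \<in> X_space p L"
    and l: "0 < l" and I: "finite I" and C: "0 \<le> C"
    and f: "f \<in> borel_measurable (lebesgue_on {0..l})"
    and dom: "AE x in lebesgue_on {0..l}. cmod (f x) \<le> C * (\<Sum>k\<in>I. cmod (cutoff L u (j k) (a k + x)))"
  shows "Lp_mem p {0..l} f \<and> Lp_norm p {0..l} f \<le> C * (real (card I))\<^sup>2 * X_norm p L u"
  using p
proof (cases rule: ereal_ge_1_cases)
  case 1
  note X0 = X_norm_nonneg[OF L p, of u]
  have "AE x in lebesgue. \<forall>k\<in>I. cmod (cutoff L u (j k) (a k + x)) \<le> X_norm \<infinity> L u"
    using cutoff_le_X_norm[OF L] u 1 I by (simp add: AE_finite_all)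
  then have "AE x in lebesgue_on {0..l}. \<forall>k\<in>I. cmod (cutoff L u (j k) (a k + x)) \<le> X_norm \<infinity> L u"
    by (auto simp: AE_restrict_space_iff elim!: eventually_mono)
  with dom have "AE x in lebesgue_on {0..l}. cmod (f x) \<le> C * (real (card I) * X_norm p L u)"
  proof eventually_elim
    case (elim x)
    have "(\<Sum>k\<in>I. cmod (cutoff L u (j k) (a k + x))) \<le> real (card I) * X_norm p L u"
      using elim 1 by (intro sum_bounded_above) auto
    then show ?case using elim(1) C mult_left_mono by fastforce
  qed
  then have "Lp_mem p {0..l} f \<and> Lp_norm p {0..l} f \<le> C * (real (card I) * X_norm p L u)"
    using Lp_norm_infinity_le[OF l f] 1 by simp
  moreover have "C * (real (card I) * X_norm p L u) \<le> C * ((real (card I))\<^sup>2 * X_norm p L u)"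
    using C X0 self_le_power[of "card I" 2]
    by (intro mult_left_mono mult_right_mono) (cases "card I = 0", auto simp flip: of_nat_power)
  ultimately show ?thesis by (simp add: mult.assoc)
next
  case (2 r)
  define m where "m = real (card I)"
  define b where "b k x = cmod (cutoff L u (j k) (a k + x))" for k x
  define G where "G x = (\<Sum>k\<in>I. b k x powr r)" for x
  note X0 = X_norm_nonneg[OF L p, of u]
  have b: "integrable lebesgue (\<lambda>x. b k x powr r)"
    "(\<integral>x. b k x powr r \<partial>lebesgue) \<le> X_norm p L u powr r" for k
  proof -
    show "integrable lebesgue (\<lambda>x. b k x powr r)"
      unfolding b_def using cutoff_powr_integral(1) u 2 by blast
    have "(\<integral>x. b k x powr r \<partial>lebesgue) \<le> Lp_norm p {0..L $ j k} (u (j k)) powr r"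
      unfolding b_def using cutoff_powr_integral(2) u 2 by blast
    also have "\<dots> \<le> X_norm p L u powr r"
      using 2 Lp_norm_le_X_norm[OF L p] Lp_norm_nonneg[OF L] by (intro powr_mono2) auto
    finally show "(\<integral>x. b k x powr r \<partial>lebesgue) \<le> X_norm p L u powr r" .
  qed
  have G: "integrable lebesgue G" unfolding G_def using b by auto
  have G0: "0 \<le> G x" for x unfolding G_def by (intro sum_nonneg) auto
  have G': "integrable lebesgue (\<lambda>x. indicator {0..l} x *\<^sub>R G x)"
    using G by (intro integrable_mult_indicator) auto
  have "(\<integral>x. G x \<partial>lebesgue_on {0..l}) = (\<integral>x. indicator {0..l} x *\<^sub>R G x \<partial>lebesgue)"
    by (simp add: integral_restrict_space)
  also have "\<dots> \<le> integral\<^sup>L lebesgue G"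
    using G G' G0 by (intro integral_mono) (auto simp: indicator_def)
  also have "\<dots> = (\<Sum>k\<in>I. \<integral>x. b k x powr r \<partial>lebesgue)"
    unfolding G_def using b by (intro Bochner_Integration.integral_sum) auto
  also have "\<dots> \<le> m * X_norm p L u powr r"
    unfolding m_def using b by (intro sum_bounded_above) auto
  finally have intG: "(\<integral>x. G x \<partial>lebesgue_on {0..l}) \<le> m * X_norm p L u powr r" .
  have G'': "integrable (lebesgue_on {0..l}) G"
    using G' by (simp add: integrable_restrict_space)
  have bound: "AE x in lebesgue_on {0..l}. cmod (f x) powr r \<le> (C * m) powr r * G x"
    using dom
  proof eventually_elim
    case (elim x)
    have "cmod (f x) powr r \<le> (C * (\<Sum>k\<in>I. b k x)) powr r"
      using elim 2 by (intro powr_mono2) (auto simp: b_def)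
    also have "\<dots> = C powr r * (\<Sum>k\<in>I. b k x) powr r"
      using C by (simp add: powr_mult sum_nonneg b_def)
    also have "\<dots> \<le> C powr r * (m powr r * G x)"
      unfolding m_def G_def using 2 I by (intro mult_left_mono sum_powr_le) (auto simp: b_def)
    also have "\<dots> = (C * m) powr r * G x"
      using C by (simp add: powr_mult m_def)
    finally show ?case .
  qed
  have fint: "integrable (lebesgue_on {0..l}) (\<lambda>x. cmod (f x) powr r)"
  proof (rule Bochner_Integration.integrable_bound)
    show "integrable (lebesgue_on {0..l}) (\<lambda>x. (C * m) powr r * G x)" using G'' by simp
    show "(\<lambda>x. cmod (f x) powr r) \<in> borel_measurable (lebesgue_on {0..l})" using f by simp
    show "AE x in lebesgue_on {0..l}. norm (cmod (f x) powr r) \<le> norm ((C * m) powr r * G x)"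
      using bound G0 by simp
  qed
  have "(\<integral>x. cmod (f x) powr r \<partial>lebesgue_on {0..l}) \<le> (\<integral>x. (C * m) powr r * G x \<partial>lebesgue_on {0..l})"
    using fint G'' bound by (intro integral_mono_AE) auto
  also have "\<dots> = (C * m) powr r * (\<integral>x. G x \<partial>lebesgue_on {0..l})" by simp
  also have "\<dots> \<le> (C * m) powr r * (m * X_norm p L u powr r)"
    using intG by (intro mult_left_mono) auto
  also have "\<dots> \<le> (C * m) powr r * (m powr r * X_norm p L u powr r)"
  proof (intro mult_left_mono mult_right_mono)
    \<comment> \<open>As a cardinality, \<open>m\<close> is either 0 or at least 1.\<close>
    show "m \<le> m powr r"
    proof (cases "card I = 0")
      case False
      then have "1 \<le> m" by (simp add: m_def Suc_leI)
      then have "m powr 1 \<le> m powr r" using 2 by (intro powr_mono) auto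
      then show ?thesis using \<open>1 \<le> m\<close> by simp
    qed (simp add: m_def)
  qed auto
  also have "\<dots> = (C * m\<^sup>2 * X_norm p L u) powr r"
    using C X0 by (simp add: powr_mult m_def power2_eq_square)
  finally have "Lp_norm (ereal r) {0..l} f \<le> C * m\<^sup>2 * X_norm p L u"
    using 2 C X0 by (intro Lp_norm_le) auto
  then show ?thesis using 2 f fint by (simp add: Lp_mem_def m_def)
qed

subsection \<open>Decay of solutions from decay of class sums\<close>

lemma path_coeff_induct:
  assumes "\<And>n j. (n \<noteq> (\<lambda>_. 0) \<Longrightarrow> n j \<noteq> 0 \<Longrightarrow> (\<And>k. Q (n(j := n j - 1)) k)) \<Longrightarrow> Q n j"
  shows "Q (n :: 'n::finite \<Rightarrow> nat) j"
proof (rule path_coeff.induct[of "\<lambda>_ _ n j. Q n j"])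
  fix m :: "('n \<Rightarrow> nat) \<Rightarrow> complex ^ 'n ^ 'n" and i n j
  assume "\<And>k. n \<noteq> (\<lambda>_. 0) \<Longrightarrow> n j \<noteq> 0 \<Longrightarrow> k \<in> UNIV \<Longrightarrow> Q (n(j := n j - 1)) k"
  then show "Q n j" by (rule assms) auto
qed

lemma entry_affine_measurable:
  fixes M :: "real \<Rightarrow> complex ^ 'n ^ 'n"
  assumes "M \<in> borel_measurable lebesgue"
  shows "(\<lambda>t. M (t - a) $ k $ j) \<in> borel_measurable lebesgue"
proof -
  have "(\<lambda>t. M (- a + 1 * t)) \<in> borel_measurable lebesgue"
    by (rule measurable_compose[OF lebesgue_measurable_affine assms]) simp
  then have M: "(\<lambda>t. M (t - a)) \<in> borel_measurable lebesgue"
    by simp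
  have "continuous_on UNIV (\<lambda>x::complex ^ 'n ^ 'n. x $ k $ j)"
    by (intro continuous_intros)
  then show ?thesis
    by (intro borel_measurable_continuous_on[OF _ M])
qed

lemma path_coeff_measurable:
  fixes L :: "real ^ 'n"
  assumes "M \<in> borel_measurable lebesgue"
  shows "(\<lambda>t. path_coeff (\<lambda>n. M (t - delay L n)) i n j) \<in> borel_measurable lebesgue"
proof (induction n j rule: path_coeff_induct)
  case (1 n j)
  show ?case
  proof (cases "n = (\<lambda>_. 0) \<or> n j = 0")
    case True
    then have "(\<lambda>t. path_coeff (\<lambda>n. M (t - delay L n)) i n j) =
        (\<lambda>_. if n = (\<lambda>_. 0) \<and> i = j then 1 else 0)"
      by (cases "n = (\<lambda>_. 0)") (simp_all add: path_coeff_zero path_coeff_eq_0)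
    then show ?thesis by simp
  next
    case False
    then show ?thesis
      using 1 entry_affine_measurable[OF assms]
      by (subst path_coeff.simps) (auto intro!: borel_measurable_sum borel_measurable_times simp del: fun_upd_apply)
  qed
qed

text \<open>A path has \<open>sum n UNIV\<close> steps; each one offers at most
  \<open>CARD('n)\<close> predecessors and contributes a factor at most \<open>b\<close>.\<close>

lemma norm_path_coeff_le:
  fixes m :: "('n::finite \<Rightarrow> nat) \<Rightarrow> complex ^ 'n ^ 'n"
  assumes b: "\<And>n k j. cmod (m n $ k $ j) \<le> b"
  shows "cmod (path_coeff m i n j) \<le> (real CARD('n) * b) ^ sum n UNIV"
proof (induction n j rule: path_coeff_induct)
  case (1 n j)
  have b0: "0 \<le> b" using b[of n j j] norm_ge_zero order_trans by blast
  consider "n = (\<lambda>_. 0)" | "n \<noteq> (\<lambda>_. 0)" "n j = 0" | "n \<noteq> (\<lambda>_. 0)" "n j \<noteq> 0" by blast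
  then show ?case
  proof cases
    case 3
    define n' where "n' = n(j := n j - 1)"
    have "Suc (n j - 1) = n j" using 3 by simp
    then have n: "n = n'(j := Suc (n' j))" by (simp add: n'_def)
    have "sum n UNIV = (\<Sum>i\<in>UNIV. n' i + (if i = j then 1 else 0))"
      by (subst n) (auto intro!: sum.cong)
    then have s: "sum n UNIV = Suc (sum n' UNIV)" by (simp add: sum.distrib)
    have "cmod (path_coeff m i n j) \<le> (\<Sum>k\<in>(UNIV::'n set). (real CARD('n) * b) ^ sum n' UNIV * b)"
    proof (subst n, unfold path_coeff_step, rule sum_norm_le)
      fix k
      show "cmod (path_coeff m i n' k * m n' $ k $ j) \<le> (real CARD('n) * b) ^ sum n' UNIV * b"
        unfolding norm_mult n'_def using b0 by (intro mult_mono 1 3 b) auto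
    qed
    also have "\<dots> = (real CARD('n) * b) ^ sum n UNIV" by (simp add: s)
    finally show ?thesis .
  qed (use b0 in \<open>auto simp: path_coeff.simps\<close>)
qed

text \<open>The expansion is read at the time \<open>T - x\<close>, which lies between
  \<open>- (L $ i)\<close> and \<open>T\<close>.\<close>

lemma state_expansion:
  fixes L :: "real ^ 'n"
  assumes L: "\<And>i. 0 < L $ i" and sol: "transport_solution L M u0 v"
    and X: "0 \<le> X" "\<And>j. T + L $ j \<le> X" and T: "0 \<le> T"
  shows "AE x in lebesgue. x \<in> {0..L $ i} \<longrightarrow> state_at v T i x =
    (\<Sum>j\<in>UNIV. \<Sum>n | delay L n \<le> X.
      path_coeff (\<lambda>n. M (T - x - delay L n)) i n j * cutoff L u0 j (delay L n - (T - x)))"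
proof -
  have "AE x in lebesgue. \<forall>i. - (L $ i) \<le> T + -1 * x \<and> T + -1 * x \<le> T \<longrightarrow> v i (T + -1 * x) =
    (\<Sum>j\<in>UNIV. \<Sum>n | delay L n \<le> X.
      path_coeff (\<lambda>n. M (T + -1 * x - delay L n)) i n j * cutoff L u0 j (delay L n - (T + -1 * x)))"
    by (rule AE_lebesgue_affine[OF transport_solution_expansion[OF L sol X]]) simp
  then show ?thesis
    by (rule eventually_mono) (use T in \<open>auto simp: state_at_def\<close>)
qed

text \<open>The notion of solution demands no measurability of \<open>v\<close>. It follows because
  the expansion is measurable and agrees with the state off a null set, Lebesgue measure being
  complete.\<close>

lemma state_measurable:
  fixes L :: "real ^ 'n"
  assumes L: "\<And>i. 0 < L $ i" and sol: "transport_solution L M u0 v"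
    and M: "M \<in> borel_measurable lebesgue" and u0: "u0 \<in> X_space p L" and T: "0 \<le> T"
  shows "state_at v T i \<in> borel_measurable (lebesgue_on {0..L $ i})"
proof -
  define X where "X = T + (\<Sum>j\<in>UNIV. L $ j)"
  have X: "0 \<le> X" "T + L $ j \<le> X" for j
    unfolding X_def using L T
    by (auto simp: less_imp_le intro!: add_nonneg_nonneg sum_nonneg member_le_sum)
  define W where "W t = (\<Sum>j\<in>UNIV. \<Sum>n | delay L n \<le> X.
      path_coeff (\<lambda>n. M (t - delay L n)) i n j * cutoff L u0 j (delay L n - t))" for t
  have "(\<lambda>t. cutoff L u0 j (delay L n - t)) \<in> borel_measurable lebesgue" for j n
    using cutoff_affine_measurable[OF u0, of "-1" j "delay L n"] by simp
  then have W: "W \<in> borel_measurable lebesgue"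
    unfolding W_def using path_coeff_measurable[OF M]
    by (intro borel_measurable_sum borel_measurable_times) auto
  have "(\<lambda>x. W (T + (-1) * x)) \<in> borel_measurable lebesgue"
    by (rule measurable_compose[OF lebesgue_measurable_affine W]) simp
  then have "(\<lambda>x. W (T - x)) \<in> borel_measurable (lebesgue_on {0..L $ i})"
    by (intro measurable_restrict_space1) simp
  then have "(\<lambda>x. indicator {0..L $ i} x *\<^sub>R W (T - x)) \<in> borel_measurable lebesgue"
    by (simp add: borel_measurable_restrict_space_iff)
  moreover have "AE x in lebesgue. indicator {0..L $ i} x *\<^sub>R W (T - x) =
      indicator {0..L $ i} x *\<^sub>R state_at v T i x"
    using state_expansion[OF L sol X T, of i]
    by (rule eventually_mono) (auto simp: W_def indicator_def)
  ultimately have "(\<lambda>x. indicator {0..L $ i} x *\<^sub>R state_at v T i x) \<in> borel_measurable lebesgue"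
    by (rule borel_measurable_AE)
  then show ?thesis by (simp add: borel_measurable_restrict_space_iff)
qed

text \<open>Reduces norm bounds to pointwise bounds on coefficient sums. It serves both the
  well-posedness in L^p, with a crude \<open>C\<close>, and the stability estimate, with
  \<open>C\<close> decaying in \<open>T\<close>.\<close>

lemma state_Lp_bound:
  fixes L :: "real ^ 'n"
  assumes L: "\<And>i. 0 < L $ i" and sol: "transport_solution L M u0 v"
    and M: "M \<in> borel_measurable lebesgue" and p: "1 \<le> p" and u0: "u0 \<in> X_space p L" and T: "0 \<le> T"
    and X: "0 \<le> X" "\<And>j. T + L $ j \<le> X" and C: "0 \<le> C"
    and coeff: "\<And>x j. 0 \<le> x \<Longrightarrow> x \<le> L $ i \<Longrightarrow>
      cmod (\<Sum>n | delay L n \<le> X.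
        path_coeff (\<lambda>n. M (T - x - delay L n)) i n j * cutoff L u0 j (delay L n - (T - x)))
      \<le> C * (\<Sum>n | delay L n \<le> X. cmod (cutoff L u0 j (delay L n - (T - x))))"
  shows "Lp_mem p {0..L $ i} (state_at v T i) \<and> Lp_norm p {0..L $ i} (state_at v T i) \<le>
    C * (real CARD('n) * real (card {n. delay L n \<le> X}))\<^sup>2 * X_norm p L u0"
proof -
  let ?A = "{n. delay L n \<le> X}"
  let ?I = "(UNIV :: 'n set) \<times> ?A"
  have fin: "finite ?A" by (rule finite_delay_le[OF L])
  have "AE x in lebesgue_on {0..L $ i}. cmod (state_at v T i x) \<le>
      C * (\<Sum>k\<in>?I. cmod (cutoff L u0 (fst k) ((delay L (snd k) - T) + x)))"
    unfolding AE_restrict_space_iff[of "{0..L $ i}" lebesgue, simplified]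
    using state_expansion[OF L sol X T, of i]
  proof (rule AE_mp, intro AE_I2 impI)
    fix x
    assume x: "0 \<le> x \<and> x \<le> L $ i" and "x \<in> {0..L $ i} \<longrightarrow> state_at v T i x =
    (\<Sum>j\<in>UNIV. \<Sum>n | delay L n \<le> X.
      path_coeff (\<lambda>n. M (T - x - delay L n)) i n j * cutoff L u0 j (delay L n - (T - x)))"
    then have "cmod (state_at v T i x) \<le>
        (\<Sum>j\<in>UNIV. C * (\<Sum>n\<in>?A. cmod (cutoff L u0 j (delay L n - (T - x)))))"
      using coeff by (auto intro!: sum_norm_le)
    also have "\<dots> = C * (\<Sum>k\<in>?I. cmod (cutoff L u0 (fst k) ((delay L (snd k) - T) + x)))"
      by (simp add: sum_distrib_left sum.cartesian_product case_prod_beta algebra_simps)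
    finally show "cmod (state_at v T i x) \<le>
      C * (\<Sum>k\<in>?I. cmod (cutoff L u0 (fst k) ((delay L (snd k) - T) + x)))" .
  qed
  from Lp_dominated[OF L p u0 L _ C state_measurable[OF L sol M u0 T] this] fin
  show ?thesis by (simp add: card_cartesian_product)
qed

text \<open>At a fixed time only finitely many coefficients matter, and each is bounded since the
  signal takes values in a bounded set.\<close>

lemma X_space_flow_invariant:
  fixes L :: "real ^ 'n"
  assumes L: "\<And>i. 0 < L $ i" and B: "bounded B" and M: "M \<in> measurable_signals B" and p: "1 \<le> p"
  shows "flow_invariant L M (X_space p L)"
  unfolding flow_invariant_def
proof (intro ballI allI impI)
  fix u0 v T
  assume u0: "u0 \<in> X_space p L" and sol: "transport_solution L M u0 v" and T: "(0::real) \<le> T"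
  define X where "X = T + (\<Sum>j\<in>UNIV. L $ j)"
  have X: "0 \<le> X" "T + L $ j \<le> X" for j
    unfolding X_def using L T
    by (auto simp: less_imp_le intro!: add_nonneg_nonneg sum_nonneg member_le_sum)
  obtain b where b: "\<And>x. x \<in> B \<Longrightarrow> norm x \<le> b"
    using B by (auto simp: bounded_iff)
  have Mb: "cmod (M t $ k $ j) \<le> b" for t k j
  proof -
    have "cmod (M t $ k $ j) \<le> norm (M t)"
      by (meson Finite_Cartesian_Product.norm_nth_le order_trans)
    also have "\<dots> \<le> b" using M b by (auto simp: measurable_signals_def)
    finally show ?thesis .
  qed
  have b0: "0 \<le> b" using Mb[of 0 undefined undefined] norm_ge_zero order_trans by blast
  define C where "C = (\<Sum>n | delay L n \<le> X. (real CARD('n) * b) ^ sum n UNIV)"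
  have fin: "finite {n. delay L n \<le> X}" by (rule finite_delay_le[OF L])
  have C0: "0 \<le> C" unfolding C_def using b0 by (intro sum_nonneg) auto
  have "Lp_mem p {0..L $ i} (state_at v T i)" for i
  proof (rule state_Lp_bound[OF L sol _ p u0 T X C0, THEN conjunct1])
    show "M \<in> borel_measurable lebesgue" using M by (simp add: measurable_signals_def)
    fix x j
    have "cmod (path_coeff (\<lambda>n. M (T - x - delay L n)) i n j) \<le> C" if "delay L n \<le> X" for n
    proof -
      have "cmod (path_coeff (\<lambda>n. M (T - x - delay L n)) i n j) \<le> (real CARD('n) * b) ^ sum n UNIV"
        by (rule norm_path_coeff_le) (rule Mb)
      also have "\<dots> \<le> C" unfolding C_def
        using that fin b0 by (intro member_le_sum) auto
      finally show ?thesis .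
    qed
    then show "cmod (\<Sum>n | delay L n \<le> X.
        path_coeff (\<lambda>n. M (T - x - delay L n)) i n j * cutoff L u0 j (delay L n - (T - x)))
      \<le> C * (\<Sum>n | delay L n \<le> X. cmod (cutoff L u0 j (delay L n - (T - x))))"
      unfolding sum_distrib_left by (intro sum_norm_le) (auto simp: norm_mult intro!: mult_right_mono)
  qed
  then show "state_at v T \<in> X_space p L" by (simp add: X_space_def)
qed

section \<open>Grouping of counts into classes, and decay of solutions\<close>

lemma V_plus_delay_eq:
  assumes "L \<in> V_plus \<Lambda>" "delay \<Lambda> n = delay \<Lambda> n'"
  shows "delay L n = delay L n'"
proof -
  \<comment> \<open>Two counts in one class differ by an integer relation of
    \<open>\<Lambda>\<close>, which is a relation of \<open>L\<close> as well.\<close>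
  define z where "z = (\<chi> i. int (n i) - int (n' i))"
  have "(\<Sum>i\<in>UNIV. K $ i * of_int (z $ i)) = delay K n - delay K n'" for K :: "real ^ 'a"
    by (simp add: z_def delay_def right_diff_distrib sum_subtractf)
  then have "z \<in> Z_rel K \<longleftrightarrow> delay K n = delay K n'" for K :: "real ^ 'a"
    by (simp add: Z_rel_def)
  then show ?thesis using assms by (auto simp: V_plus_def)
qed

text \<open>\<open>A\<close> is a union of level sets of \<open>h\<close> on which \<open>g\<close>
  is constant, so \<open>g\<close> factors out of each level. Only the sums of \<open>P\<close> over
  levels are controlled, which preserves cancellation among the paths of a class.\<close>

lemma norm_grouped_sum_le:
  fixes P g :: "'a \<Rightarrow> complex" and h :: "'a \<Rightarrow> 'b"
  assumes A: "finite A" "\<And>n n'. h n = h n' \<Longrightarrow> n \<in> A \<Longrightarrow> n' \<in> A"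
    and g: "\<And>n n'. h n = h n' \<Longrightarrow> g n = g n'"
    and P: "\<And>y. cmod (\<Sum>n | h n = y. P n) \<le> \<kappa> y"
  shows "cmod (\<Sum>n\<in>A. P n * g n) \<le> (\<Sum>n\<in>A. \<kappa> (h n) * cmod (g n))"
proof -
  have k0: "0 \<le> \<kappa> y" for y using P[of y] norm_ge_zero order_trans by blast
  have "cmod (\<Sum>n\<in>{n\<in>A. h n = y}. P n * g n) \<le> (\<Sum>n\<in>{n\<in>A. h n = y}. \<kappa> (h n) * cmod (g n))"
    if y: "y \<in> h ` A" for y
  proof -
    obtain k where k: "k \<in> A" "h k = y" using y by auto
    have "{n\<in>A. h n = y} = {n. h n = y}" using A(2)[of k] k by auto
    moreover have "(\<Sum>n\<in>{n\<in>A. h n = y}. P n * g n) = (\<Sum>n\<in>{n\<in>A. h n = y}. P n) * g k"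
      unfolding sum_distrib_right using g k by (intro sum.cong) auto
    ultimately have "cmod (\<Sum>n\<in>{n\<in>A. h n = y}. P n * g n) \<le> \<kappa> (h k) * cmod (g k)"
      using P[of y] k by (simp add: norm_mult mult_right_mono)
    also have "\<dots> \<le> (\<Sum>n\<in>{n\<in>A. h n = y}. \<kappa> (h n) * cmod (g n))"
      using A k k0 by (intro member_le_sum[of k "{n\<in>A. h n = y}" "\<lambda>n. \<kappa> (h n) * cmod (g n)"]) auto
    finally show ?thesis .
  qed
  then show ?thesis
    unfolding sum.image_gen[OF A(1), of _ h] by (rule sum_norm_le)
qed

lemma affine_power_le_exp:
  fixes \<alpha> S d :: real
  assumes "0 < \<alpha>" "0 < d" "0 \<le> S" "0 < k"
  shows "\<exists>K>0. \<forall>T\<ge>0. ((T + S) / d + 1) ^ k \<le> K * exp (\<alpha> * T)"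
proof -
  \<comment> \<open>Chosen so that the inequality \<open>y \<le> c * exp (y / c)\<close>, raised to
    the power \<open>k\<close>, yields exactly the rate \<open>\<alpha>\<close> in
    \<open>T\<close>.\<close>
  define c where "c = real k / (\<alpha> * d)"
  have c: "0 < c" using assms by (simp add: c_def)
  have "((T + S) / d + 1) ^ k \<le> (c ^ k * exp (\<alpha> * (S + d))) * exp (\<alpha> * T)" if T: "0 \<le> T" for T
  proof -
    define y where "y = (T + S) / d + 1"
    have y: "0 \<le> y" using assms T by (simp add: y_def)
    have "y / c \<le> exp (y / c)" using exp_ge_add_one_self[of "y / c"] by linarith
    then have "y \<le> c * exp (y / c)" using c by (simp add: field_simps)
    then have "y ^ k \<le> (c * exp (y / c)) ^ k" using y by (rule power_mono)
    also have "\<dots> = c ^ k * exp (real k * (y / c))" by (simp only: power_mult_distrib exp_of_nat_mult)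
    also have "real k * (y / c) = \<alpha> * (S + d) + \<alpha> * T"
      using assms by (simp add: c_def y_def field_simps)
    finally show ?thesis by (simp add: y_def exp_add mult.assoc)
  qed
  then show ?thesis using c by (intro exI[of _ "c ^ k * exp (\<alpha> * (S + d))"]) auto
qed

text \<open>A signal read at the times \<open>t - delay L n\<close> has this form for every
  \<open>L\<close> in \<open>V_plus \<Lambda>\<close>, so one family of coefficients serves all
  these delay vectors.\<close>

definition class_signals :: "real ^ 'n \<Rightarrow> 'b set \<Rightarrow> (('n \<Rightarrow> nat) \<Rightarrow> 'b) set" where
  "class_signals \<Lambda> B =
    {m. (\<forall>n. m n \<in> B) \<and> (\<forall>n n'. delay \<Lambda> n = delay \<Lambda> n' \<longrightarrow> m n = m n')}"

lemma exponential_decay_of_class_sums: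
  fixes \<Lambda> L :: "real ^ 'n"
  assumes \<Lambda>: "\<And>i. 0 < \<Lambda> $ i" and V: "L \<in> V_plus \<Lambda>" and a: "0 < a" and K: "0 \<le> K"
    and coeff: "\<And>m i j x. m \<in> class_signals \<Lambda> B \<Longrightarrow>
      cmod (\<Sum>n | delay \<Lambda> n = x. path_coeff m i n j) \<le> K * exp (- a * x)"
  shows "\<exists>b>0. \<exists>K'>0. \<forall>p\<ge>1. \<forall>M\<in>measurable_signals B. \<forall>u0\<in>X_space p L. \<forall>v.
    transport_solution L M u0 v \<longrightarrow>
    (\<forall>T\<ge>0. X_norm p L (state_at v T) \<le> K' * exp (- b * T) * X_norm p L u0)"
proof -
  have L: "0 < L $ i" for i using V by (simp add: V_plus_def)
  define S where "S = (\<Sum>j\<in>UNIV. L $ j)"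
  have S: "L $ j \<le> S" for j unfolding S_def using L by (intro member_le_sum) (auto simp: less_imp_le)
  have S0: "0 \<le> S" using S[of undefined] L[of undefined] by linarith
  \<comment> \<open>The largest constant with \<open>c * L $ i \<le> \<Lambda> $ i\<close> for all
    \<open>i\<close>; it turns decay in the \<open>\<Lambda>\<close>-delay into decay in the
    \<open>L\<close>-delay, and so in time.\<close>
  define c where "c = Min (range (\<lambda>i. \<Lambda> $ i / L $ i))"
  have c: "0 < c" unfolding c_def using \<Lambda> L by (subst Min_gr_iff) auto
  have cle: "c * L $ i \<le> \<Lambda> $ i" for i
  proof -
    have "c \<le> \<Lambda> $ i / L $ i" unfolding c_def by (intro Min_le) auto
    then show ?thesis using L[of i] by (simp add: field_simps)
  qed
  have dcle: "c * delay L n \<le> delay \<Lambda> n" for n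
    unfolding delay_def sum_distrib_left using cle
    by (intro sum_mono) (simp add: mult.assoc[symmetric] mult_right_mono)
  obtain d where d: "0 < d" "\<And>X. 0 \<le> X \<Longrightarrow> real (card {n. delay L n \<le> X}) \<le> (X / d + 1) ^ CARD('n)"
    using finite_card_delay_le[OF L] by blast
  \<comment> \<open>Half of the rate \<open>a * c\<close> is spent on the number of counts. The
    exponent is doubled because that number enters \<open>state_Lp_bound\<close> squared.\<close>
  obtain K2 where K2: "0 < K2" "\<And>T. 0 \<le> T \<Longrightarrow> ((T + S) / d + 1) ^ (CARD('n) * 2) \<le> K2 * exp (a * c / 2 * T)"
    using affine_power_le_exp[of "a * c / 2" d S "CARD('n) * 2"] a c d S0 by auto
  define N where "N = real CARD('n)"
  have N: "0 < N" by (simp add: N_def)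
  \<comment> \<open>\<open>K + 1\<close> in place of \<open>K\<close> makes the constant positive
    even when \<open>K = 0\<close>.\<close>
  define K' where "K' = N * ((K + 1) * exp (a * c * S) * (N\<^sup>2 * K2))"
  have K': "0 < K'" using K K2 N by (simp add: K'_def)
  have main: "X_norm p L (state_at v T) \<le> K' * exp (- (a * c / 2) * T) * X_norm p L u0"
    if p: "1 \<le> p" and M: "M \<in> measurable_signals B" and u0: "u0 \<in> X_space p L"
      and sol: "transport_solution L M u0 v" and T: "0 \<le> T" for p M u0 v T
  proof -
    define X where "X = T + S"
    have X: "0 \<le> X" "\<And>j. T + L $ j \<le> X" using S S0 T by (auto simp: X_def)
    define C where "C = (K + 1) * exp (a * c * S) * exp (- a * c * T)"
    have C0: "0 \<le> C" using K by (simp add: C_def)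
    let ?A = "{n. delay L n \<le> X}"
    have Xn: "0 \<le> X_norm p L u0" using X_norm_nonneg[OF L p] .
    have *: "Lp_norm p {0..L $ i} (state_at v T i) \<le> C * (N * real (card ?A))\<^sup>2 * X_norm p L u0" for i
      unfolding N_def
    proof (rule state_Lp_bound[OF L sol _ p u0 T X C0, THEN conjunct2])
      show "M \<in> borel_measurable lebesgue" using M by (simp add: measurable_signals_def)
      fix x j assume x: "0 \<le> x" "x \<le> L $ i"
      have "cmod (\<Sum>n\<in>?A. path_coeff (\<lambda>n. M (T - x - delay L n)) i n j * cutoff L u0 j (delay L n - (T - x)))
        \<le> (\<Sum>n\<in>?A. K * exp (- a * delay \<Lambda> n) * cmod (cutoff L u0 j (delay L n - (T - x))))"
      proof (rule norm_grouped_sum_le[of ?A "delay \<Lambda>"])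
        show "finite ?A" by (rule finite_delay_le[OF L])
        show "cmod (\<Sum>n | delay \<Lambda> n = y. path_coeff (\<lambda>n. M (T - x - delay L n)) i n j) \<le> K * exp (- a * y)" for y
        proof (rule coeff)
          have eq: "M (T - x - delay L n) = M (T - x - delay L n')" if "delay \<Lambda> n = delay \<Lambda> n'" for n n'
            by (simp only: V_plus_delay_eq[OF V that])
          have "M t \<in> B" for t using M by (simp add: measurable_signals_def)
          then show "(\<lambda>n. M (T - x - delay L n)) \<in> class_signals \<Lambda> B"
            unfolding class_signals_def mem_Collect_eq by (intro conjI allI impI eq)
        qed
        fix n n' assume eq: "delay \<Lambda> n = delay \<Lambda> n'"
        show "n \<in> ?A \<Longrightarrow> n' \<in> ?A" by (simp add: V_plus_delay_eq[OF V eq])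
        show "cutoff L u0 j (delay L n - (T - x)) = cutoff L u0 j (delay L n' - (T - x))"
          by (simp only: V_plus_delay_eq[OF V eq])
      qed
      also have "\<dots> \<le> (\<Sum>n\<in>?A. C * cmod (cutoff L u0 j (delay L n - (T - x))))"
      proof (rule sum_mono)
        fix n
        show "K * exp (- a * delay \<Lambda> n) * cmod (cutoff L u0 j (delay L n - (T - x))) \<le>
          C * cmod (cutoff L u0 j (delay L n - (T - x)))"
        \<comment> \<open>Where the cutoff can be nonzero, \<open>delay L n\<close> exceeds
          \<open>T - x\<close>, hence is at least \<open>T - S\<close>; this makes the class sum
          small in \<open>T\<close>.\<close>
        proof (cases "0 < delay L n - (T - x)")
          case True
          have "T - S \<le> delay L n" using True x S[of i] by simp
          then have "c * (T - S) \<le> delay \<Lambda> n"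
            using dcle[of n] c mult_left_mono[of "T - S" "delay L n" c] by linarith
          then have "a * (c * (T - S)) \<le> a * delay \<Lambda> n" using a by (intro mult_left_mono) auto
          then have "- a * delay \<Lambda> n \<le> a * c * S + - a * c * T" by (simp add: algebra_simps)
          then have "exp (- a * delay \<Lambda> n) \<le> exp (a * c * S) * exp (- a * c * T)"
            by (simp add: exp_add[symmetric])
          then have "K * exp (- a * delay \<Lambda> n) \<le> (K + 1) * (exp (a * c * S) * exp (- a * c * T))"
            using K by (intro mult_mono) auto
          then show ?thesis by (intro mult_right_mono) (auto simp: C_def mult.assoc)
        qed (simp add: cutoff_def)
      qed
      finally show "cmod (\<Sum>n\<in>?A. path_coeff (\<lambda>n. M (T - x - delay L n)) i n j * cutoff L u0 j (delay L n - (T - x)))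
        \<le> C * (\<Sum>n\<in>?A. cmod (cutoff L u0 j (delay L n - (T - x))))"
        by (simp add: sum_distrib_left)
    qed
    have "X_norm p L (state_at v T) \<le> N * (C * (N * real (card ?A))\<^sup>2 * X_norm p L u0)"
      unfolding N_def using C0 Xn * by (intro X_norm_le[OF L p]) (auto simp: N_def)
    also have "\<dots> \<le> N * (C * (N\<^sup>2 * (K2 * exp (a * c / 2 * T))) * X_norm p L u0)"
    proof -
      have "(real (card ?A))\<^sup>2 \<le> (((T + S) / d + 1) ^ CARD('n))\<^sup>2"
        using d(2)[OF X(1)] by (intro power_mono) (auto simp: X_def)
      also have "\<dots> \<le> K2 * exp (a * c / 2 * T)"
        using K2(2)[OF T] by (simp add: power_mult)
      finally show ?thesis using N C0 Xn unfolding power_mult_distrib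
        by (intro mult_left_mono mult_right_mono) auto
    qed
    also have "\<dots> = K' * (exp (- a * c * T) * exp (a * c / 2 * T)) * X_norm p L u0"
      by (simp add: K'_def C_def)
    also have "exp (- a * c * T) * exp (a * c / 2 * T) = exp (- (a * c / 2) * T)"
      by (simp add: exp_add[symmetric])
    finally show ?thesis .
  qed
  have ac: "0 < a * c / 2" using a c by simp
  have "\<forall>p\<ge>1. \<forall>M\<in>measurable_signals B. \<forall>u0\<in>X_space p L. \<forall>v. transport_solution L M u0 v \<longrightarrow>
    (\<forall>T\<ge>0. X_norm p L (state_at v T) \<le> K' * exp (- (a * c / 2) * T) * X_norm p L u0)"
  proof (intro allI ballI impI)
    fix p :: ereal and M u0 v and T :: real
    assume "1 \<le> p" "M \<in> measurable_signals B" "u0 \<in> X_space p L" "transport_solution L M u0 v" "0 \<le> T"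
    then show "X_norm p L (state_at v T) \<le> K' * exp (- (a * c / 2) * T) * X_norm p L u0"
      by (rule main)
  qed
  with ac K' show ?thesis by blast
qed

subsection \<open>Decay of class sums from stability\<close>

lemma finite_real_separation:
  fixes W :: "real set"
  assumes "finite W"
  obtains \<delta> where "0 < \<delta>" "\<And>w w'. w \<in> W \<Longrightarrow> w' \<in> W \<Longrightarrow> w \<noteq> w' \<Longrightarrow> 2 * \<delta> \<le> \<bar>w - w'\<bar>"
proof -
  define D where "D = (\<lambda>(w, w'). \<bar>w - w'\<bar>) ` {(w, w') \<in> W \<times> W. w \<noteq> w'}"
  have "finite {(w, w') \<in> W \<times> W. w \<noteq> w'}"
    by (rule finite_subset[of _ "W \<times> W"]) (use assms in auto)
  \<comment> \<open>The element 1 keeps the minimum meaningful when \<open>W\<close> has no two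
    distinct points.\<close>
  then have D: "finite (insert 1 D)" by (simp add: D_def)
  show ?thesis
  proof (rule that[of "Min (insert 1 D) / 2"])
    have "0 < Min (insert 1 D)" using D by (subst Min_gr_iff) (auto simp: D_def)
    then show "0 < Min (insert 1 D) / 2" by simp
    fix w w' assume "w \<in> W" "w' \<in> W" "w \<noteq> w'"
    then have "\<bar>w - w'\<bar> \<in> insert 1 D" by (force simp: D_def)
    then have "Min (insert 1 D) \<le> \<bar>w - w'\<bar>" using D by (intro Min_le)
    then show "2 * (Min (insert 1 D) / 2) \<le> \<bar>w - w'\<bar>" by simp
  qed
qed

text \<open>The balls of radius \<open>\<delta>\<close> around the nodes are disjoint, so the signal
  can be overwritten on one ball after another without disturbing the earlier ones.\<close>

lemma measurable_signal_interpolation: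
  fixes f :: "real \<Rightarrow> complex ^ 'n ^ 'n"
  assumes "finite W" "B \<noteq> {}"
    and "\<And>w w'. w \<in> W \<Longrightarrow> w' \<in> W \<Longrightarrow> w \<noteq> w' \<Longrightarrow> 2 * \<delta> \<le> \<bar>w - w'\<bar>"
    and "\<And>w. w \<in> W \<Longrightarrow> f w \<in> B"
  shows "\<exists>M\<in>measurable_signals B. \<forall>w\<in>W. \<forall>t. \<bar>t - w\<bar> < \<delta> \<longrightarrow> M t = f w"
  using assms
proof (induction W)
  case empty
  then obtain b where "b \<in> B" by auto
  then have "(\<lambda>_. b) \<in> measurable_signals B" by (simp add: measurable_signals_def)
  then show ?case by auto
next
  case (insert w W)
  then obtain M where M: "M \<in> measurable_signals B" "\<forall>w\<in>W. \<forall>t. \<bar>t - w\<bar> < \<delta> \<longrightarrow> M t = f w"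
    by (metis insert_iff)
  define M' where "M' t = (if t \<in> ball w \<delta> then f w else M t)" for t
  have "M' \<in> borel_measurable lebesgue"
    unfolding M'_def using M by (intro measurable_If_set) (auto simp: measurable_signals_def)
  then have "M' \<in> measurable_signals B"
    using M insert.prems by (auto simp: measurable_signals_def M'_def)
  moreover have "M' t = f w'" if "w' \<in> insert w W" "\<bar>t - w'\<bar> < \<delta>" for w' t
  proof (cases "w' = w")
    case True
    then show ?thesis using that by (simp add: M'_def dist_real_def abs_minus_commute)
  next
    case False
    then have "2 * \<delta> \<le> \<bar>w - w'\<bar>" "w' \<in> W" using insert.prems that by auto
    then show ?thesis using that M by (auto simp: M'_def dist_real_def)
  qed
  ultimately show ?case by blast
qed

text \<open>Mean zero places it in every \<open>Y_space\<close>. Its modulus is 1 on all of the open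
  interval, the centre being counted in the left half, so a class sum can be read off without
  loss.\<close>

definition bump :: "real \<Rightarrow> real \<Rightarrow> real \<Rightarrow> complex" where
  "bump \<theta> \<delta> y = indicator {\<theta> - \<delta><..\<theta>} y - indicator {\<theta><..<\<theta> + \<delta>} y"

lemma cmod_bump: "0 < \<delta> \<Longrightarrow> cmod (bump \<theta> \<delta> y) = indicator {\<theta> - \<delta><..<\<theta> + \<delta>} y"
  by (auto simp: bump_def indicator_def)

lemma bump_measurable [measurable]: "bump \<theta> \<delta> \<in> borel_measurable lebesgue"
proof -
  have "bump \<theta> \<delta> \<in> borel_measurable borel" unfolding bump_def by measurable
  then show ?thesis by (simp add: measurable_completion)
qed

lemma integral_indicator_sub:
  fixes l :: real
  assumes "J \<in> sets lebesgue" "J \<subseteq> {0..l}"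
  shows "integrable (lebesgue_on {0..l}) (indicator J :: real \<Rightarrow> real)"
    "(\<integral>x. indicator J x \<partial>lebesgue_on {0..l}) = measure lebesgue J"
proof -
  have J: "J \<in> sets (lebesgue_on {0..l})" using assms by (simp add: sets_restrict_space_iff)
  have "emeasure lebesgue J \<le> emeasure lebesgue {0..l}" using assms by (intro emeasure_mono) auto
  also have "\<dots> < \<infinity>" by (simp add: emeasure_lborel_Icc_eq)
  finally have "emeasure (lebesgue_on {0..l}) J < \<infinity>"
    using assms by (simp add: emeasure_restrict_space)
  then show "integrable (lebesgue_on {0..l}) (indicator J :: real \<Rightarrow> real)"
    using J by simp
  show "(\<integral>x. indicator J x \<partial>lebesgue_on {0..l}) = measure lebesgue J"
    using assms by (simp add: measure_restrict_space Int_absorb2)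
qed

lemma bump_integral:
  assumes "0 < \<delta>" "0 \<le> \<theta> - \<delta>" "\<theta> + \<delta> \<le> l"
  shows "(\<integral>x. bump \<theta> \<delta> x \<partial>lebesgue_on {0..l}) = 0"
proof -
  have eq: "bump \<theta> \<delta> x = complex_of_real (indicator {\<theta> - \<delta><..\<theta>} x - indicator {\<theta><..<\<theta> + \<delta>} x)" for x
    by (simp add: bump_def indicator_def)
  have "{\<theta> - \<delta><..\<theta>} \<subseteq> {0..l}" "{\<theta><..<\<theta> + \<delta>} \<subseteq> {0..l}" using assms by auto
  note J = this[THEN integral_indicator_sub(1)[rotated]] this[THEN integral_indicator_sub(2)[rotated]]
  have "(\<integral>x. indicator {\<theta> - \<delta><..\<theta>} x - indicator {\<theta><..<\<theta> + \<delta>} x \<partial>lebesgue_on {0..l}) = (0::real)"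
    using J assms by (subst Bochner_Integration.integral_diff) auto
  then show ?thesis unfolding eq integral_complex_of_real by simp
qed

lemma bump_Lp:
  assumes \<delta>: "0 < \<delta>" "0 \<le> \<theta> - \<delta>" "\<theta> + \<delta> \<le> l" and p: "1 \<le> p"
  shows "Lp_mem p {0..l} (bump \<theta> \<delta>)"
    "Lp_norm p {0..l} (bump \<theta> \<delta>) \<le> (2 * \<delta>) powr (1 / real_of_ereal p)"
proof -
  have meas: "bump \<theta> \<delta> \<in> borel_measurable (lebesgue_on {0..l})"
    by (intro measurable_restrict_space1) simp
  have "Lp_mem p {0..l} (bump \<theta> \<delta>) \<and>
    Lp_norm p {0..l} (bump \<theta> \<delta>) \<le> (2 * \<delta>) powr (1 / real_of_ereal p)"
    using p
  proof (cases rule: ereal_ge_1_cases)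
    case 1
    \<comment> \<open>For \<open>p = \<infinity>\<close> the exponent is \<open>1 / 0 = 0\<close>,
      so the claimed bound is 1.\<close>
    have "Lp_mem \<infinity> {0..l} (bump \<theta> \<delta>) \<and> Lp_norm \<infinity> {0..l} (bump \<theta> \<delta>) \<le> 1"
      using \<delta> meas by (intro Lp_norm_infinity_le AE_I2) (auto simp: cmod_bump indicator_def)
    then show ?thesis using 1 \<delta> by simp
  next
    case (2 r)
    have "{\<theta> - \<delta><..<\<theta> + \<delta>} \<subseteq> {0..l}" using \<delta> by auto
    note J = integral_indicator_sub[OF _ this]
    have eq: "(\<lambda>x. cmod (bump \<theta> \<delta> x) powr r) = indicator {\<theta> - \<delta><..<\<theta> + \<delta>}"
      using 2 \<delta> by (auto simp: cmod_bump indicator_def)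
    have "(\<integral>x. cmod (bump \<theta> \<delta> x) powr r \<partial>lebesgue_on {0..l}) = 2 * \<delta>"
      unfolding eq using J(2) \<delta> by simp
    moreover have "integrable (lebesgue_on {0..l}) (\<lambda>x. cmod (bump \<theta> \<delta> x) powr r)"
      unfolding eq using J(1) by simp
    ultimately show ?thesis using 2 meas by (simp add: Lp_mem_def Lp_norm_def)
  qed
  then show "Lp_mem p {0..l} (bump \<theta> \<delta>)"
    "Lp_norm p {0..l} (bump \<theta> \<delta>) \<le> (2 * \<delta>) powr (1 / real_of_ereal p)"
    by auto
qed

lemma Lp_zero:
  assumes "0 < l" "1 \<le> p"
  shows "Lp_mem p {0..l} (\<lambda>_. 0)" "Lp_norm p {0..l} (\<lambda>_. 0) = 0"
proof -
  have "Lp_mem p {0..l} (\<lambda>_. 0) \<and> Lp_norm p {0..l} (\<lambda>_. 0) \<le> 0"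
    using assms(2)
  proof (cases rule: ereal_ge_1_cases)
    case 1
    then show ?thesis using assms Lp_norm_infinity_le[of l "\<lambda>_. 0" 0] by simp
  qed (simp add: Lp_mem_def Lp_norm_def)
  then show "Lp_mem p {0..l} (\<lambda>_. 0)" "Lp_norm p {0..l} (\<lambda>_. 0) = 0"
    using Lp_norm_nonneg[OF assms(1), of p "\<lambda>_. 0"] by auto
qed

lemma X_norm_single:
  fixes L :: "real ^ 'n"
  assumes L: "\<And>i. 0 < L $ i" and p: "1 \<le> p"
  shows "X_norm p L (\<lambda>k. if k = j then f else (\<lambda>_. 0)) = Lp_norm p {0..L $ j} f"
  using p
proof (cases rule: ereal_ge_1_cases)
  case 1
  have "Lp_norm p {0..L $ k} (if k = j then f else (\<lambda>_. 0)) \<le> Lp_norm p {0..L $ j} f" for k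
    using Lp_zero[OF L p] Lp_norm_nonneg[OF L] by auto
  then show ?thesis using 1
    by (auto simp: X_norm_def intro!: Max_eqI)
next
  case (2 r)
  have "(\<Sum>k\<in>UNIV. Lp_norm p {0..L $ k} (if k = j then f else (\<lambda>_. 0)) powr r) =
      (\<Sum>k\<in>UNIV. if k = j then Lp_norm p {0..L $ j} f powr r else 0)"
    using Lp_zero[OF L p] by (intro sum.cong) auto
  then show ?thesis
    using 2 powr_powr_inverse[OF Lp_norm_nonneg[OF L]] by (simp add: X_norm_def)
qed

text \<open>For \<open>p = \<infinity>\<close> the exponent \<open>1 / real_of_ereal p\<close> is \<open>1 / 0 = 0\<close>, as it should be.\<close>

lemma Lp_norm_ge:
  assumes \<delta>: "0 < \<delta>" "2 * \<delta> \<le> l" and p: "1 \<le> p" and f: "Lp_mem p {0..l} f" and s: "0 \<le> s"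
    and ae: "AE x in lebesgue. x \<in> {0<..<2 * \<delta>} \<longrightarrow> cmod (f x) = s"
  shows "s * (2 * \<delta>) powr (1 / real_of_ereal p) \<le> Lp_norm p {0..l} f"
  using p
proof (cases rule: ereal_ge_1_cases)
  case 1
  have "AE x in lebesgue_on {0..l}. cmod (f x) \<le> Lp_norm \<infinity> {0..l} f"
    using \<delta> f 1 by (intro AE_cmod_le_Lp_norm_infinity) auto
  then have "AE x in lebesgue. x \<in> {0..l} \<longrightarrow> cmod (f x) \<le> Lp_norm \<infinity> {0..l} f"
    by (simp add: AE_restrict_space_iff)
  with ae have ev: "AE x in lebesgue. x \<in> {0<..<2 * \<delta>} \<longrightarrow> s \<le> Lp_norm \<infinity> {0..l} f"
    by eventually_elim (use \<delta> in auto)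
  have "s \<le> Lp_norm \<infinity> {0..l} f"
  proof (rule ccontr)
    assume "\<not> s \<le> Lp_norm \<infinity> {0..l} f"
    with ev have "AE x in lebesgue. x \<notin> {0<..<2 * \<delta>}" by (auto elim!: eventually_mono)
    moreover have "(AE x in lebesgue. x \<notin> {0<..<2 * \<delta>}) \<longleftrightarrow> emeasure lebesgue {0<..<2 * \<delta>} = 0"
      by (rule AE_iff_measurable) auto
    ultimately have "emeasure lebesgue {0<..<2 * \<delta>} = 0" by blast
    then show False using \<delta> by simp
  qed
  then show ?thesis using 1 \<delta> by simp
next
  case (2 r)
  have "{0<..<2 * \<delta>} \<subseteq> {0..l}" using \<delta> by auto
  note J = integral_indicator_sub[OF _ this]
  have "s powr r * (2 * \<delta>) = (\<integral>x. s powr r * indicator {0<..<2 * \<delta>} x \<partial>lebesgue_on {0..l})"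
    using J \<delta> by simp
  also have "\<dots> \<le> (\<integral>x. cmod (f x) powr r \<partial>lebesgue_on {0..l})"
  proof (rule integral_mono_AE)
    show "integrable (lebesgue_on {0..l}) (\<lambda>x. s powr r * indicator {0<..<2 * \<delta>} x)"
      using J(1) by simp
    show "integrable (lebesgue_on {0..l}) (\<lambda>x. cmod (f x) powr r)"
      using f 2 by (simp add: Lp_mem_def)
    show "AE x in lebesgue_on {0..l}. s powr r * indicator {0<..<2 * \<delta>} x \<le> cmod (f x) powr r"
      unfolding AE_restrict_space_iff[of "{0..l}" lebesgue, simplified]
      using ae by eventually_elim (auto simp: indicator_def)
  qed
  finally have "(s powr r * (2 * \<delta>)) powr (1 / r) \<le> Lp_norm p {0..l} f"
    using 2 s \<delta> by (auto simp: Lp_norm_def intro!: powr_mono2)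
  moreover have "(s powr r * (2 * \<delta>)) powr (1 / r) = s * (2 * \<delta>) powr (1 / r)"
    using s \<delta> 2 powr_powr_inverse[of s r] by (simp add: powr_mult)
  ultimately show ?thesis using 2 by simp
qed

text \<open>A bump in component \<open>j\<close> and a signal that realizes \<open>m\<close> near
  the relevant times. At time \<open>T\<close>, on the window \<open>(0, 2 * \<delta>)\<close> of
  component \<open>i\<close>, the solution is the class sum times a number of modulus 1;
  \<open>q\<close> is the size of the bump.\<close>

lemma class_sum_test_solution:
  fixes \<Lambda> :: "real ^ 'n"
  assumes \<Lambda>: "\<And>i. 0 < \<Lambda> $ i" and B: "bounded B" and p: "1 \<le> p"
    and m_class: "m \<in> class_signals \<Lambda> B" and y: "\<Lambda> $ j \<le> y"
  shows "\<exists>T M u0 v q. 0 \<le> T \<and> y - \<Lambda> $ j \<le> T \<and> M \<in> measurable_signals B \<and> u0 \<in> Y_space p \<Lambda> R \<and>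
    transport_solution \<Lambda> M u0 v \<and> 0 < q \<and> X_norm p \<Lambda> u0 \<le> q \<and>
    cmod (\<Sum>n | delay \<Lambda> n = y. path_coeff m i n j) * q \<le> X_norm p \<Lambda> (state_at v T)"
proof -
  have m: "m n \<in> B" "delay \<Lambda> n = delay \<Lambda> n' \<Longrightarrow> m n = m n'" for n n'
    using m_class unfolding class_signals_def by blast+
  define X where "X = y + (\<Sum>j\<in>UNIV. \<Lambda> $ j)"
  have S: "\<Lambda> $ k \<le> (\<Sum>j\<in>UNIV. \<Lambda> $ j)" for k
    using \<Lambda> by (intro member_le_sum) (auto simp: less_imp_le)
  define A where "A = {n. delay \<Lambda> n \<le> X}"
  have fin: "finite A" unfolding A_def by (rule finite_delay_le[OF \<Lambda>])
  have yX: "y \<le> X" using S[of j] \<Lambda>[of j] by (simp add: X_def)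
  \<comment> \<open>The bump sits in the middle of the component \<open>j\<close>, and at time
    \<open>t0\<close> the class of delay \<open>y\<close> reads exactly its centre.\<close>
  define \<theta> where "\<theta> = \<Lambda> $ j / 2"
  define t0 where "t0 = y - \<theta>"
  obtain \<delta>' where \<delta>': "0 < \<delta>'"
    "\<And>w w'. w \<in> insert y (delay \<Lambda> ` A) \<Longrightarrow> w' \<in> insert y (delay \<Lambda> ` A) \<Longrightarrow> w \<noteq> w' \<Longrightarrow> 2 * \<delta>' \<le> \<bar>w - w'\<bar>"
    using finite_real_separation[of "insert y (delay \<Lambda> ` A)"] fin by blast
  \<comment> \<open>Small enough to separate the classes, to keep the bump inside
    \<open>[0, \<Lambda> $ j]\<close> and to fit the window into
    \<open>[0, \<Lambda> $ i]\<close>.\<close>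
  define \<delta> where "\<delta> = min \<delta>' (min (\<Lambda> $ j / 4) (\<Lambda> $ i / 2))"
  have \<delta>: "0 < \<delta>" "\<delta> \<le> \<Lambda> $ j / 4" "2 * \<delta> \<le> \<Lambda> $ i"
    using \<delta>' \<Lambda>[of i] \<Lambda>[of j] by (auto simp: \<delta>_def)
  have sep: "2 * \<delta> \<le> \<bar>w - w'\<bar>"
    if "w \<in> insert y (delay \<Lambda> ` A)" "w' \<in> insert y (delay \<Lambda> ` A)" "w \<noteq> w'" for w w'
    using \<delta>'(2)[OF that] by (simp add: \<delta>_def)
  \<comment> \<open>The choice of \<open>n\<close> is immaterial because \<open>m\<close> is
    constant on classes; where no such \<open>n\<close> exists the value still lies in
    \<open>B\<close>.\<close>
  define f where "f w = m (SOME n. delay \<Lambda> n = t0 - w)" for w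
  have f: "f (t0 - delay \<Lambda> n) = m n" for n
    unfolding f_def by (rule m(2), rule someI2[of _ n]) auto
  have "\<exists>M\<in>measurable_signals B. \<forall>w\<in>(\<lambda>n. t0 - delay \<Lambda> n) ` A. \<forall>t. \<bar>t - w\<bar> < \<delta> \<longrightarrow> M t = f w"
  proof (rule measurable_signal_interpolation)
    show "finite ((\<lambda>n. t0 - delay \<Lambda> n) ` A)" using fin by simp
    show "B \<noteq> {}" using m(1) by auto
    show "f w \<in> B" for w by (simp add: f_def m(1))
    fix w w' assume w: "w \<in> (\<lambda>n. t0 - delay \<Lambda> n) ` A" "w' \<in> (\<lambda>n. t0 - delay \<Lambda> n) ` A" "w \<noteq> w'"
    then obtain n n' where "n \<in> A" "n' \<in> A" "w = t0 - delay \<Lambda> n" "w' = t0 - delay \<Lambda> n'" by blast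
    then show "2 * \<delta> \<le> \<bar>w - w'\<bar>" using sep[of "delay \<Lambda> n" "delay \<Lambda> n'"] w by auto
  qed
  then obtain M where M: "M \<in> measurable_signals B"
    and Mm: "\<And>n t. n \<in> A \<Longrightarrow> \<bar>t - (t0 - delay \<Lambda> n)\<bar> < \<delta> \<Longrightarrow> M t = m n"
    using f by force
  define u0 where "u0 k = (if k = j then bump \<theta> \<delta> else (\<lambda>_. 0))" for k
  define q where "q = (2 * \<delta>) powr (1 / real_of_ereal p)"
  have b: "0 < \<delta>" "0 \<le> \<theta> - \<delta>" "\<theta> + \<delta> \<le> \<Lambda> $ j"
    using \<delta> \<Lambda>[of j] by (auto simp: \<theta>_def)
  have u0X: "u0 \<in> X_space p \<Lambda>"
    using bump_Lp(1)[OF b p] Lp_zero(1)[OF \<Lambda> p] by (auto simp: X_space_def u0_def)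
  have "(\<integral>x. u0 k x \<partial>lebesgue_on {0..\<Lambda> $ k}) = 0" for k
    using bump_integral[OF b] by (auto simp: u0_def)
  then have u0Y: "u0 \<in> Y_space p \<Lambda> R" using u0X by (simp add: Y_space_def)
  have u0q: "X_norm p \<Lambda> u0 \<le> q"
    unfolding u0_def X_norm_single[OF \<Lambda> p] q_def by (rule bump_Lp(2)[OF b p])
  obtain v where sol: "transport_solution \<Lambda> M u0 v"
    using transport_solution_exists[OF \<Lambda>] by blast
  \<comment> \<open>The shift by \<open>\<delta>\<close> lets \<open>T - x\<close> run through the
    \<open>\<delta>\<close>-neighbourhood of \<open>t0\<close> as \<open>x\<close> runs through the
    window.\<close>
  define T where "T = t0 + \<delta>"
  have T: "0 \<le> T" "y - \<Lambda> $ j \<le> T" "T \<le> y"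
    using y \<delta> \<Lambda>[of j] by (auto simp: T_def t0_def \<theta>_def)
  have X: "0 \<le> X" "\<And>k. T + \<Lambda> $ k \<le> X"
    using S T y yX \<Lambda>[of j] by (auto simp: X_def add_mono)
  define s where "s = (\<Sum>n | delay \<Lambda> n = y. path_coeff m i n j)"
  have "AE x in lebesgue. x \<in> {0<..<2 * \<delta>} \<longrightarrow> cmod (state_at v T i x) = cmod s"
    using state_expansion[OF \<Lambda> sol X T(1), of i]
  proof (rule AE_mp, intro AE_I2 impI)
    fix x
    assume x: "x \<in> {0<..<2 * \<delta>}" and eq: "x \<in> {0..\<Lambda> $ i} \<longrightarrow> state_at v T i x =
      (\<Sum>k\<in>UNIV. \<Sum>n | delay \<Lambda> n \<le> X.
        path_coeff (\<lambda>n. M (T - x - delay \<Lambda> n)) i n k * cutoff \<Lambda> u0 k (delay \<Lambda> n - (T - x)))"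
    define P where "P = path_coeff (\<lambda>n. M (T - x - delay \<Lambda> n)) i"
    have cut: "cutoff \<Lambda> u0 k z = (if k = j then bump \<theta> \<delta> z else 0)" for k z
      using b by (auto simp: cutoff_def u0_def bump_def indicator_def)
    have \<sigma>: "\<bar>T - x - t0\<bar> < \<delta>" using x by (auto simp: T_def)
    have "state_at v T i x = (\<Sum>k\<in>UNIV. \<Sum>n\<in>A. P n k * cutoff \<Lambda> u0 k (delay \<Lambda> n - (T - x)))"
      using eq x \<delta> by (simp add: P_def A_def)
    also have "\<dots> = (\<Sum>k\<in>UNIV. if k = j then (\<Sum>n\<in>A. P n j * bump \<theta> \<delta> (delay \<Lambda> n - (T - x))) else 0)"
      by (intro sum.cong) (auto simp: cut)
    also have "\<dots> = (\<Sum>n\<in>A. P n j * bump \<theta> \<delta> (delay \<Lambda> n - (T - x)))"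
      by simp
    also have "\<dots> = (\<Sum>n | delay \<Lambda> n = y. path_coeff m i n j * bump \<theta> \<delta> (y - (T - x)))"
    proof (rule sum.mono_neutral_cong_right[OF fin])
      show "{n. delay \<Lambda> n = y} \<subseteq> A" using yX by (auto simp: A_def)
      show "\<forall>n\<in>A - {n. delay \<Lambda> n = y}. P n j * bump \<theta> \<delta> (delay \<Lambda> n - (T - x)) = 0"
      proof
        fix n assume n: "n \<in> A - {n. delay \<Lambda> n = y}"
        \<comment> \<open>Another class is \<open>2 * \<delta>\<close> away, and
          \<open>T - x\<close> moves the reading point by less than \<open>\<delta>\<close>, so it
          misses the bump.\<close>
        then have "2 * \<delta> \<le> \<bar>delay \<Lambda> n - y\<bar>" by (intro sep) auto
        then have "delay \<Lambda> n - (T - x) \<notin> {\<theta> - \<delta><..<\<theta> + \<delta>}"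
          using \<sigma> by (auto simp: t0_def)
        then have "bump \<theta> \<delta> (delay \<Lambda> n - (T - x)) = 0"
          using cmod_bump[OF b(1), of \<theta> "delay \<Lambda> n - (T - x)"] by simp
        then show "P n j * bump \<theta> \<delta> (delay \<Lambda> n - (T - x)) = 0" by simp
      qed
      fix n assume "n \<in> {n. delay \<Lambda> n = y}"
      then have n: "delay \<Lambda> n = y" by simp
      have "P n j = path_coeff m i n j"
        unfolding P_def
      \<comment> \<open>The signal matches \<open>m\<close> on \<open>A\<close>, which contains
        every count below one of delay \<open>y\<close>.\<close>
      proof (rule path_coeff_cong)
        fix n' assume "n' \<le> n"
        then have "delay \<Lambda> n' \<le> y" using delay_mono[OF \<Lambda>, of n' n] n by simp
        then have "n' \<in> A" using yX by (simp add: A_def)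
        then show "M (T - x - delay \<Lambda> n') = m n'" using \<sigma> by (intro Mm) auto
      qed
      then show "P n j * bump \<theta> \<delta> (delay \<Lambda> n - (T - x)) = path_coeff m i n j * bump \<theta> \<delta> (y - (T - x))"
        using n by simp
    qed
    also have "\<dots> = s * bump \<theta> \<delta> (y - (T - x))" by (simp add: s_def sum_distrib_right)
    finally have "cmod (state_at v T i x) = cmod s * cmod (bump \<theta> \<delta> (y - (T - x)))"
      by (simp add: norm_mult)
    moreover have "y - (T - x) \<in> {\<theta> - \<delta><..<\<theta> + \<delta>}" using x by (auto simp: T_def t0_def)
    ultimately show "cmod (state_at v T i x) = cmod s" by (simp add: cmod_bump[OF b(1)])
  qed
  then have "cmod s * q \<le> Lp_norm p {0..\<Lambda> $ i} (state_at v T i)"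
    unfolding q_def
  proof (rule Lp_norm_ge[OF \<delta>(1,3) p, rotated 2])
    have "state_at v T \<in> X_space p \<Lambda>"
      using X_space_flow_invariant[OF \<Lambda> B M p] u0X sol T by (auto simp: flow_invariant_def)
    then show "Lp_mem p {0..\<Lambda> $ i} (state_at v T i)" by (rule X_spaceD)
  qed simp
  also have "\<dots> \<le> X_norm p \<Lambda> (state_at v T)" by (rule Lp_norm_le_X_norm[OF \<Lambda> p])
  finally have "cmod s * q \<le> X_norm p \<Lambda> (state_at v T)" .
  moreover have "0 < q" using \<delta> by (simp add: q_def)
  ultimately show ?thesis
    using T M u0Y sol u0q unfolding s_def by blast
qed

text \<open>The stability estimate is applied to the test solution, whose time \<open>T\<close>
  falls short of \<open>y\<close> by at most one component of \<open>\<Lambda>\<close>; the bump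
  size \<open>q\<close> cancels, whatever the exponent \<open>p\<close>.\<close>

lemma class_sum_decay:
  fixes \<Lambda> :: "real ^ 'n"
  assumes \<Lambda>: "\<And>i. 0 < \<Lambda> $ i" and B: "bounded B" and p: "1 \<le> p"
    and stable: "exponentially_stable \<Lambda> (measurable_signals B) p R"
  obtains a K where "0 < a" "0 \<le> K"
    "\<And>m i j y. m \<in> class_signals \<Lambda> B \<Longrightarrow>
      cmod (\<Sum>n | delay \<Lambda> n = y. path_coeff m i n j) \<le> K * exp (- a * y)"
proof -
  obtain \<gamma> where \<gamma>: "\<gamma> < 0" and type: "exponential_type \<Lambda> (measurable_signals B) p R \<gamma>"
    using stable by (auto simp: exponentially_stable_def)
  \<comment> \<open>Serves both as the slack \<open>\<epsilon>\<close> and as the resulting rate,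
    since \<open>\<gamma> + a = - a\<close>.\<close>
  define a where "a = - \<gamma> / 2"
  have a: "0 < a" "\<gamma> + a = - a" using \<gamma> by (auto simp: a_def)
  obtain K where K: "0 < K" and est: "\<And>M u0 v t. M \<in> measurable_signals B \<Longrightarrow> u0 \<in> Y_space p \<Lambda> R \<Longrightarrow>
      transport_solution \<Lambda> M u0 v \<Longrightarrow> 0 \<le> t \<Longrightarrow>
      X_norm p \<Lambda> (state_at v t) \<le> K * exp (- a * t) * X_norm p \<Lambda> u0"
    using type[unfolded exponential_type_def, rule_format, OF a(1)] unfolding a(2) by blast
  define S where "S = (\<Sum>j\<in>UNIV. \<Lambda> $ j)"
  have S: "\<Lambda> $ k \<le> S" for k
    unfolding S_def using \<Lambda> by (intro member_le_sum) (auto simp: less_imp_le)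
  \<comment> \<open>The summand 1 covers the empty path, whose coefficient at \<open>y = 0\<close>
    can be 1.\<close>
  define K' where "K' = K * exp (a * S) + 1"
  have K': "0 \<le> K'" "1 \<le> K'" "K * exp (a * S) \<le> K'" using K by (auto simp: K'_def)
  show ?thesis
  proof (rule that[OF a(1) K'(1)])
    fix m :: "('n \<Rightarrow> nat) \<Rightarrow> complex ^ 'n ^ 'n" and i j y
    assume m: "m \<in> class_signals \<Lambda> B"
    define s where "s = (\<Sum>n | delay \<Lambda> n = y. path_coeff m i n j)"
    show "cmod s \<le> K' * exp (- a * y)"
    proof (cases "\<Lambda> $ j \<le> y")
      case True
      obtain T M u0 v q where T: "0 \<le> T" "y - \<Lambda> $ j \<le> T" and "M \<in> measurable_signals B"
        "u0 \<in> Y_space p \<Lambda> R" "transport_solution \<Lambda> M u0 v"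
        and q: "0 < q" "X_norm p \<Lambda> u0 \<le> q" "cmod s * q \<le> X_norm p \<Lambda> (state_at v T)"
        using class_sum_test_solution[OF \<Lambda> B p m True, where R = R and i = i] unfolding s_def by blast
      then have "cmod s * q \<le> K * exp (- a * T) * X_norm p \<Lambda> u0"
        using est by (meson order_trans)
      also have "\<dots> \<le> K * exp (- a * T) * q"
        using q K by (intro mult_left_mono) auto
      finally have "cmod s \<le> K * exp (- a * T)" using q by simp
      also have "\<dots> \<le> K * exp (a * S + - a * y)"
      proof -
        have "a * y \<le> a * (T + S)" using a T S[of j] by (intro mult_left_mono) auto
        then show ?thesis using K by (simp add: algebra_simps)
      qed
      also have "\<dots> = K * exp (a * S) * exp (- a * y)" by (simp only: exp_add mult.assoc)
      also have "\<dots> \<le> K' * exp (- a * y)" using K' by (intro mult_right_mono) auto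
      finally show ?thesis .
    next
      case False
      \<comment> \<open>A nonempty path ending at \<open>j\<close> has delay at least
        \<open>\<Lambda> $ j\<close>, so below that level only the empty path can count.\<close>
      have zero: "path_coeff m i n j = 0" if "delay \<Lambda> n = y" "n \<noteq> (\<lambda>_. 0)" for n
        using that False component_le_delay[OF \<Lambda>, of n j] by (intro path_coeff_eq_0) auto
      show ?thesis
      proof (cases "y = 0")
        case True
        have "s = (\<Sum>n\<in>{\<lambda>_. 0}. path_coeff m i n j)"
          unfolding s_def
        proof (rule sum.mono_neutral_right)
          show "finite {n. delay \<Lambda> n = y}"
            by (rule finite_subset[OF _ finite_delay_le[OF \<Lambda>, of y]]) auto
        qed (use True zero in auto)
        then have "cmod s \<le> 1" by (simp add: path_coeff_zero)
        then show ?thesis using True K' by simp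
      next
        case y: False
        have "n \<noteq> (\<lambda>_. 0)" if "delay \<Lambda> n = y" for n using that y by auto
        then have "s = 0" unfolding s_def using zero by (intro sum.neutral) blast
        then show ?thesis using K' by simp
      qed
    qed
  qed
qed

theorem corollary4p11:
  fixes \<Lambda> :: "real ^ 'n" and \<BB> :: "(complex ^ 'n ^ 'n) set"
  assumes "\<And>i. 0 < \<Lambda> $ i"
    and "\<BB> \<noteq> {}" and "bounded \<BB>"
  defines "\<M> \<equiv> measurable_signals \<BB>"
  shows "(\<exists>p\<ge>1. \<exists>R\<in>Inv_mats \<Lambda> \<M>. exponentially_stable \<Lambda> \<M> p R) \<longleftrightarrow>
    (\<forall>L\<in>V_plus \<Lambda>. \<forall>p\<ge>1. \<forall>R\<in>Inv_mats L \<M>. exponentially_stable L \<M> p R)"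
proof
  assume "\<exists>p\<ge>1. \<exists>R\<in>Inv_mats \<Lambda> \<M>. exponentially_stable \<Lambda> \<M> p R"
  then obtain p R where p: "1 \<le> p" and "exponentially_stable \<Lambda> (measurable_signals \<BB>) p R"
    by (auto simp: \<M>_def)
  then obtain a K where aK: "0 < a" "0 \<le> K"
    "\<And>m i j y. m \<in> class_signals \<Lambda> \<BB> \<Longrightarrow>
      cmod (\<Sum>n | delay \<Lambda> n = y. path_coeff m i n j) \<le> K * exp (- a * y)"
    using class_sum_decay[OF assms(1,3)] by blast
  show "\<forall>L\<in>V_plus \<Lambda>. \<forall>p\<ge>1. \<forall>R\<in>Inv_mats L \<M>. exponentially_stable L \<M> p R"
  proof (intro ballI allI impI)
    fix L :: "real ^ 'n" and p :: ereal and R :: "(complex ^ 'n) list"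
    assume L: "L \<in> V_plus \<Lambda>" and p: "1 \<le> p"
    have Lpos: "0 < L $ i" for i using L by (simp add: V_plus_def)
    obtain b K where bK: "0 < b" "0 < K" and est: "\<forall>p\<ge>1. \<forall>M\<in>measurable_signals \<BB>. \<forall>u0\<in>X_space p L. \<forall>v.
        transport_solution L M u0 v \<longrightarrow>
        (\<forall>T\<ge>0. X_norm p L (state_at v T) \<le> K * exp (- b * T) * X_norm p L u0)"
      using exponential_decay_of_class_sums[OF assms(1) L aK] by blast
    have "exponential_type L \<M> p R (- b)"
      unfolding exponential_type_def
    proof (intro allI impI exI[of _ K] conjI ballI)
      fix \<epsilon> :: real and M u0 v and t :: real
      assume \<epsilon>: "0 < \<epsilon>" and M: "M \<in> \<M>" and u0: "u0 \<in> Y_space p L R"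
        and sol: "transport_solution L M u0 v" and t: "0 \<le> t"
      \<comment> \<open>The decay holds on the whole state space, so it restricts to every subspace
        \<open>Y_space p L R\<close>.\<close>
      have "u0 \<in> X_space p L" using u0 by (simp add: Y_space_def)
      with est p M sol t have "X_norm p L (state_at v t) \<le> K * exp (- b * t) * X_norm p L u0"
        unfolding \<M>_def by blast
      also have "\<dots> \<le> K * exp ((- b + \<epsilon>) * t) * X_norm p L u0"
        using bK \<epsilon> t X_norm_nonneg[OF Lpos p]
        by (intro mult_right_mono mult_left_mono) (auto simp: algebra_simps)
      finally show "X_norm p L (state_at v t) \<le> K * exp ((- b + \<epsilon>) * t) * X_norm p L u0" .
    qed (rule bK)
    then show "exponentially_stable L \<M> p R"
      using bK unfolding exponentially_stable_def by (intro exI[of _ "- b"]) simp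
  qed
next
  assume "\<forall>L\<in>V_plus \<Lambda>. \<forall>p\<ge>1. \<forall>R\<in>Inv_mats L \<M>. exponentially_stable L \<M> p R"
  moreover have "\<Lambda> \<in> V_plus \<Lambda>" using assms(1) by (simp add: V_plus_def)
  \<comment> \<open>The matrix without rows imposes no condition, so its space is the full state
    space. It provides an instance of the second statement with
    \<open>L = \<Lambda>\<close>.\<close>
  moreover have inv: "[] \<in> Inv_mats \<Lambda> \<M>"
    using X_space_flow_invariant[OF assms(1,3)] by (simp add: Inv_mats_def \<M>_def Y_space_def)
  ultimately have "exponentially_stable \<Lambda> \<M> 1 []" by blast
  with inv show "\<exists>p\<ge>1. \<exists>R\<in>Inv_mats \<Lambda> \<M>. exponentially_stable \<Lambda> \<M> p R" by blast
qed

end
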